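(* Let $G$ be a finite group acting on an abelian category $\mathcal{C}$ via $g\mapsto T^g$. Let $K$ and $H$ be any two subgroups of $G$ and let $M\in\mathcal{C}^H$. Then there is an isomorphism in $\mathcal{C}^K$ $$\mathrm{Res}^G_K(\mathrm{Ind}^G_H(M))\simeq\bigoplus_{x\in D}\mathrm{Ind}^K_{K\cap{}^xH}\big(\mathrm{Res}^{{}^xH}_{{}^xH\cap K}(T^x(M))\big),$$ where $D$ is a complete set of representatives for the double cosets $K\backslash G/H$ and ${}^xH:=xHx^{-1}$.
   Context: Group actions. An action of a finite group $G$ on an abelian category $\mathcal{C}$ consists of exact autoequivalences $T^g:\mathcal{C}\to\mathcal{C}$ ($g\in G$) and natural isomorphisms $T_2^{g,h}:T^gT^h\to T^{gh}$ with $(T_2^{gh,l})_M(T_2^{g,h})_{T^l(M)}=(T_2^{g,hl})_M\,T^g((T_2^{h,l})_M)$ for all $M\in\mathcal{C}$, $g,h,l\in G$; it is assumed normalized: $T^1=\mathrm{id}_{\mathcal{C}}$ and $T_2^{g,1}$, $T_2^{1,g}$ are identities. Equivariantization. For $H\le G$, $\mathcal{C}^H$ is the abelian category of pairs $(M,\mu)$, where $M\in\mathcal{C}$ and $\mu=(\mu^h)_{h\in H}$ are isomorphisms $\mu^h:T^h(M)\to M$ with $\mu^gT^g(\mu^h)=\mu^{gh}(T_2^{g,h})_M$ for $g,h\in H$ and $\mu^1=\mathrm{id}_M$. A morphism $(M,\mu)\to(N,\nu)$ is a morphism $f:M\to N$ in $\mathcal{C}$ with $\nu^hT^h(f)=f\mu^h$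 for all $h\in H$. Restriction. For $B\le A\le G$, $\mathrm{Res}^A_B:\mathcal{C}^A\to\mathcal{C}^B$ keeps only $\mu^b$, $b\in B$. Induction. For $B\le A\le G$ and a set $\mathcal{R}$ of representatives of the left cosets $A/B$, $\mathrm{Ind}_B^A(V,\mu)=(\bigoplus_{t\in\mathcal{R}}T^t(V),\nu)$, where for $g\in A$ the map $\nu^g$ is given on the component $T^gT^t(V)$ by $T^s(\mu^b)(T_2^{s,b})_V^{-1}(T_2^{g,t})_V:T^gT^t(V)\to T^s(V)$, with $s\in\mathcal{R}$, $b\in B$ determined by $gt=sb$. It is left adjoint to $\mathrm{Res}^A_B$. Conjugation. For $x\in G$ and $M=(V,\mu)\in\mathcal{C}^H$, $T^x(M)=(T^x(V),{}^x\mu)\in\mathcal{C}^{{}^xH}$ with ${}^x\mu^{xhx^{-1}}=T^x(\mu^h)(T_2^{x,h})_V^{-1}(T_2^{xhx^{-1},x})_V$ for $h\in H$. *)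

theory Defs
  imports "HOL-Algebra.Coset" "HOL-Algebra.FiniteProduct"
begin

section \<open>Abelian categories\<close>

text \<open>
  A category is given by a set of objects, hom-sets, identities and a composition; the last two
  fields are the addition and the zero of the hom-sets. Composition and addition
  are total functions whose values matter only on composable, respectively parallel, morphisms.
  Hom-sets are not required to be disjoint; this allows a morphism of the equivariantization
  to be literally a morphism of the underlying category.
\<close>

record ('o, 'm) cat =
  Obj :: "'o set"
  Mor :: "'o \<Rightarrow> 'o \<Rightarrow> 'm set"
  Idn :: "'o \<Rightarrow> 'm"
  Cmp :: "'m \<Rightarrow> 'm \<Rightarrow> 'm"  (infixl "\<cdot>\<index>" 70)
  Pls :: "'m \<Rightarrow> 'm \<Rightarrow> 'm"
  Zro :: "'o \<Rightarrow> 'o \<Rightarrow> 'm"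

definition hom_grp :: "('o, 'm) cat \<Rightarrow> 'o \<Rightarrow> 'o \<Rightarrow> 'm monoid" where
  "hom_grp C A B = \<lparr>carrier = Mor C A B, monoid.mult = Pls C, one = Zro C A B\<rparr>"

locale category =
  fixes C :: "('o, 'm) cat" (structure)
  assumes idn_in: "A \<in> Obj C \<Longrightarrow> Idn C A \<in> Mor C A A"
    and cmp_in: "\<lbrakk>A \<in> Obj C; B \<in> Obj C; E \<in> Obj C; f \<in> Mor C A B; g \<in> Mor C B E\<rbrakk>
      \<Longrightarrow> g \<cdot> f \<in> Mor C A E"
    and cmp_assoc: "\<lbrakk>A \<in> Obj C; B \<in> Obj C; E \<in> Obj C; F \<in> Obj C;
        f \<in> Mor C A B; g \<in> Mor C B E; h \<in> Mor C E F\<rbrakk>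
      \<Longrightarrow> h \<cdot> g \<cdot> f = h \<cdot> (g \<cdot> f)"
    and idn_left: "\<lbrakk>A \<in> Obj C; B \<in> Obj C; f \<in> Mor C A B\<rbrakk> \<Longrightarrow> Idn C B \<cdot> f = f"
    and idn_right: "\<lbrakk>A \<in> Obj C; B \<in> Obj C; f \<in> Mor C A B\<rbrakk> \<Longrightarrow> f \<cdot> Idn C A = f"

locale preadditive_category = category +
  assumes hom_comm_group: "\<lbrakk>A \<in> Obj C; B \<in> Obj C\<rbrakk> \<Longrightarrow> comm_group (hom_grp C A B)"
    and cmp_pls_right: "\<lbrakk>A \<in> Obj C; B \<in> Obj C; E \<in> Obj C;
        f \<in> Mor C A B; f' \<in> Mor C A B; g \<in> Mor C B E\<rbrakk>
      \<Longrightarrow> g \<cdot> Pls C f f' = Pls C (g \<cdot> f) (g \<cdot> f')"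
    and cmp_pls_left: "\<lbrakk>A \<in> Obj C; B \<in> Obj C; E \<in> Obj C;
        f \<in> Mor C A B; g \<in> Mor C B E; g' \<in> Mor C B E\<rbrakk>
      \<Longrightarrow> Pls C g g' \<cdot> f = Pls C (g \<cdot> f) (g' \<cdot> f)"

definition is_iso :: "('o, 'm) cat \<Rightarrow> 'o \<Rightarrow> 'o \<Rightarrow> 'm \<Rightarrow> bool" where
  "is_iso C A B f \<longleftrightarrow> f \<in> Mor C A B \<and>
     (\<exists>g\<in>Mor C B A. g \<cdot>\<^bsub>C\<^esub> f = Idn C A \<and> f \<cdot>\<^bsub>C\<^esub> g = Idn C B)"

definition inverse_mor :: "('o, 'm) cat \<Rightarrow> 'o \<Rightarrow> 'o \<Rightarrow> 'm \<Rightarrow> 'm" where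
  "inverse_mor C A B f =
     (THE g. g \<in> Mor C B A \<and> g \<cdot>\<^bsub>C\<^esub> f = Idn C A \<and> f \<cdot>\<^bsub>C\<^esub> g = Idn C B)"

definition isomorphic :: "('o, 'm) cat \<Rightarrow> 'o \<Rightarrow> 'o \<Rightarrow> bool" where
  "isomorphic C A B \<longleftrightarrow> A \<in> Obj C \<and> B \<in> Obj C \<and> (\<exists>f. is_iso C A B f)"

definition is_zero_object :: "('o, 'm) cat \<Rightarrow> 'o \<Rightarrow> bool" where
  "is_zero_object C Z \<longleftrightarrow> Z \<in> Obj C \<and>
     (\<forall>A\<in>Obj C. (\<exists>!f. f \<in> Mor C Z A) \<and> (\<exists>!f. f \<in> Mor C A Z))"

definition is_direct_sum ::
  "('o, 'm) cat \<Rightarrow> 'i set \<Rightarrow> ('i \<Rightarrow> 'o) \<Rightarrow> 'o \<Rightarrow> ('i \<Rightarrow> 'm) \<Rightarrow> ('i \<Rightarrow> 'm) \<Rightarrow> bool" where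
  "is_direct_sum C I F P \<iota> \<pi> \<longleftrightarrow> finite I \<and> P \<in> Obj C \<and>
     (\<forall>i\<in>I. F i \<in> Obj C \<and> \<iota> i \<in> Mor C (F i) P \<and> \<pi> i \<in> Mor C P (F i)) \<and>
     (\<forall>i\<in>I. \<forall>j\<in>I. \<pi> j \<cdot>\<^bsub>C\<^esub> \<iota> i = (if i = j then Idn C (F i) else Zro C (F i) (F j))) \<and>
     finprod (hom_grp C P P) (\<lambda>i. \<iota> i \<cdot>\<^bsub>C\<^esub> \<pi> i) I = Idn C P"

definition is_kernel :: "('o, 'm) cat \<Rightarrow> 'o \<Rightarrow> 'o \<Rightarrow> 'm \<Rightarrow> 'o \<Rightarrow> 'm \<Rightarrow> bool" where
  "is_kernel C A B f K k \<longleftrightarrow> K \<in> Obj C \<and> k \<in> Mor C K A \<and> f \<cdot>\<^bsub>C\<^esub> k = Zro C K B \<and>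
     (\<forall>Y\<in>Obj C. \<forall>h\<in>Mor C Y A. f \<cdot>\<^bsub>C\<^esub> h = Zro C Y B \<longrightarrow>
        (\<exists>!u. u \<in> Mor C Y K \<and> k \<cdot>\<^bsub>C\<^esub> u = h))"

definition is_cokernel :: "('o, 'm) cat \<Rightarrow> 'o \<Rightarrow> 'o \<Rightarrow> 'm \<Rightarrow> 'o \<Rightarrow> 'm \<Rightarrow> bool" where
  "is_cokernel C A B f Q q \<longleftrightarrow> Q \<in> Obj C \<and> q \<in> Mor C B Q \<and> q \<cdot>\<^bsub>C\<^esub> f = Zro C A Q \<and>
     (\<forall>Y\<in>Obj C. \<forall>h\<in>Mor C B Y. h \<cdot>\<^bsub>C\<^esub> f = Zro C A Y \<longrightarrow>
        (\<exists>!u. u \<in> Mor C Q Y \<and> u \<cdot>\<^bsub>C\<^esub> q = h))"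

definition is_mono :: "('o, 'm) cat \<Rightarrow> 'o \<Rightarrow> 'o \<Rightarrow> 'm \<Rightarrow> bool" where
  "is_mono C A B f \<longleftrightarrow> f \<in> Mor C A B \<and>
     (\<forall>Y\<in>Obj C. \<forall>u\<in>Mor C Y A. \<forall>v\<in>Mor C Y A. f \<cdot>\<^bsub>C\<^esub> u = f \<cdot>\<^bsub>C\<^esub> v \<longrightarrow> u = v)"

definition is_epi :: "('o, 'm) cat \<Rightarrow> 'o \<Rightarrow> 'o \<Rightarrow> 'm \<Rightarrow> bool" where
  "is_epi C A B f \<longleftrightarrow> f \<in> Mor C A B \<and>
     (\<forall>Y\<in>Obj C. \<forall>u\<in>Mor C B Y. \<forall>v\<in>Mor C B Y. u \<cdot>\<^bsub>C\<^esub> f = v \<cdot>\<^bsub>C\<^esub> f \<longrightarrow> u = v)"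

locale abelian_category = preadditive_category +
  assumes ex_zero_object: "\<exists>Z. is_zero_object C Z"
    and ex_binary_direct_sum: "\<lbrakk>A \<in> Obj C; B \<in> Obj C\<rbrakk>
      \<Longrightarrow> \<exists>P \<iota> \<pi>. is_direct_sum C (UNIV :: bool set) (\<lambda>i. if i then A else B) P \<iota> \<pi>"
    and ex_kernel: "\<lbrakk>A \<in> Obj C; B \<in> Obj C; f \<in> Mor C A B\<rbrakk> \<Longrightarrow> \<exists>K k. is_kernel C A B f K k"
    and ex_cokernel: "\<lbrakk>A \<in> Obj C; B \<in> Obj C; f \<in> Mor C A B\<rbrakk> \<Longrightarrow> \<exists>Q q. is_cokernel C A B f Q q"
    and mono_is_kernel: "\<lbrakk>A \<in> Obj C; B \<in> Obj C; is_mono C A B f\<rbrakk>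
      \<Longrightarrow> \<exists>E\<in>Obj C. \<exists>g\<in>Mor C B E. is_kernel C B E g A f"
    and epi_is_cokernel: "\<lbrakk>A \<in> Obj C; B \<in> Obj C; is_epi C A B f\<rbrakk>
      \<Longrightarrow> \<exists>E\<in>Obj C. \<exists>g\<in>Mor C E A. is_cokernel C E A g B f"

text \<open>
  A fixed choice of a direct sum of a finite family, with its injections and projections.
  Direct sums are unique up to isomorphism, so the choice is immaterial.
\<close>

definition dsum :: "('o, 'm) cat \<Rightarrow> 'i set \<Rightarrow> ('i \<Rightarrow> 'o) \<Rightarrow> 'o \<times> ('i \<Rightarrow> 'm) \<times> ('i \<Rightarrow> 'm)" where
  "dsum C I F = (SOME (P, \<iota>, \<pi>). is_direct_sum C I F P \<iota> \<pi>)"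

definition dsum_obj :: "('o, 'm) cat \<Rightarrow> 'i set \<Rightarrow> ('i \<Rightarrow> 'o) \<Rightarrow> 'o" where
  "dsum_obj C I F = fst (dsum C I F)"

definition dsum_inj :: "('o, 'm) cat \<Rightarrow> 'i set \<Rightarrow> ('i \<Rightarrow> 'o) \<Rightarrow> 'i \<Rightarrow> 'm" where
  "dsum_inj C I F = fst (snd (dsum C I F))"


section \<open>Exact autoequivalences\<close>

record ('o, 'm) endofun =
  fobj :: "'o \<Rightarrow> 'o"
  fmor :: "'m \<Rightarrow> 'm"

definition id_fun :: "('o, 'm) endofun" where
  "id_fun = \<lparr>fobj = (\<lambda>A. A), fmor = (\<lambda>f. f)\<rparr>"

definition comp_fun :: "('o, 'm) endofun \<Rightarrow> ('o, 'm) endofun \<Rightarrow> ('o, 'm) endofun" where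
  "comp_fun F F' = \<lparr>fobj = fobj F \<circ> fobj F', fmor = fmor F \<circ> fmor F'\<rparr>"

definition is_functor :: "('o, 'm) cat \<Rightarrow> ('o, 'm) endofun \<Rightarrow> bool" where
  "is_functor C F \<longleftrightarrow>
     (\<forall>A\<in>Obj C. fobj F A \<in> Obj C \<and> fmor F (Idn C A) = Idn C (fobj F A)) \<and>
     (\<forall>A\<in>Obj C. \<forall>B\<in>Obj C. \<forall>f\<in>Mor C A B. fmor F f \<in> Mor C (fobj F A) (fobj F B)) \<and>
     (\<forall>A\<in>Obj C. \<forall>B\<in>Obj C. \<forall>E\<in>Obj C. \<forall>f\<in>Mor C A B. \<forall>g\<in>Mor C B E.
        fmor F (g \<cdot>\<^bsub>C\<^esub> f) = fmor F g \<cdot>\<^bsub>C\<^esub> fmor F f)"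

definition nat_iso ::
  "('o, 'm) cat \<Rightarrow> ('o, 'm) endofun \<Rightarrow> ('o, 'm) endofun \<Rightarrow> ('o \<Rightarrow> 'm) \<Rightarrow> bool" where
  "nat_iso C F F' \<eta> \<longleftrightarrow>
     (\<forall>A\<in>Obj C. is_iso C (fobj F A) (fobj F' A) (\<eta> A)) \<and>
     (\<forall>A\<in>Obj C. \<forall>B\<in>Obj C. \<forall>f\<in>Mor C A B. \<eta> B \<cdot>\<^bsub>C\<^esub> fmor F f = fmor F' f \<cdot>\<^bsub>C\<^esub> \<eta> A)"

definition is_autoequivalence :: "('o, 'm) cat \<Rightarrow> ('o, 'm) endofun \<Rightarrow> bool" where
  "is_autoequivalence C F \<longleftrightarrow> is_functor C F \<and>
     (\<exists>F' \<eta> \<epsilon>. is_functor C F' \<and>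
        nat_iso C id_fun (comp_fun F' F) \<eta> \<and> nat_iso C (comp_fun F F') id_fun \<epsilon>)"

definition is_short_exact :: "('o, 'm) cat \<Rightarrow> 'o \<Rightarrow> 'm \<Rightarrow> 'o \<Rightarrow> 'm \<Rightarrow> 'o \<Rightarrow> bool" where
  "is_short_exact C A f B g E \<longleftrightarrow> is_kernel C B E g A f \<and> is_cokernel C A B f E g"

definition is_exact :: "('o, 'm) cat \<Rightarrow> ('o, 'm) endofun \<Rightarrow> bool" where
  "is_exact C F \<longleftrightarrow>
     (\<forall>A\<in>Obj C. \<forall>B\<in>Obj C. \<forall>f\<in>Mor C A B. \<forall>f'\<in>Mor C A B.
        fmor F (Pls C f f') = Pls C (fmor F f) (fmor F f')) \<and>
     (\<forall>A\<in>Obj C. \<forall>B\<in>Obj C. \<forall>E\<in>Obj C. \<forall>f\<in>Mor C A B. \<forall>g\<in>Mor C B E.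
        is_short_exact C A f B g E \<longrightarrow>
        is_short_exact C (fobj F A) (fmor F f) (fobj F B) (fmor F g) (fobj F E))"


section \<open>Group actions and equivariantization\<close>

text \<open>The morphism \<open>T2 g h M\<close> is the component at \<open>M\<close> of the isomorphism from
  \<open>T g\<close> after \<open>T h\<close> to \<open>T (g h)\<close>.\<close>

locale categorical_action =
  fixes G :: "('g, 'a) monoid_scheme" (structure)
    and C :: "('o, 'm) cat"
    and T :: "'g \<Rightarrow> ('o, 'm) endofun"
    and T2 :: "'g \<Rightarrow> 'g \<Rightarrow> 'o \<Rightarrow> 'm"
  assumes T_autoequivalence: "g \<in> carrier G \<Longrightarrow> is_autoequivalence C (T g)"
    and T_exact: "g \<in> carrier G \<Longrightarrow> is_exact C (T g)"
    and T2_nat_iso: "\<lbrakk>g \<in> carrier G; h \<in> carrier G\<rbrakk>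
      \<Longrightarrow> nat_iso C (comp_fun (T g) (T h)) (T (g \<otimes> h)) (T2 g h)"
    and T2_coherence:
      "\<lbrakk>M \<in> Obj C; g \<in> carrier G; h \<in> carrier G; l \<in> carrier G\<rbrakk>
      \<Longrightarrow> T2 (g \<otimes> h) l M \<cdot>\<^bsub>C\<^esub> T2 g h (fobj (T l) M)
        = T2 g (h \<otimes> l) M \<cdot>\<^bsub>C\<^esub> fmor (T g) (T2 h l M)"
    and T_one_obj: "A \<in> Obj C \<Longrightarrow> fobj (T \<one>) A = A"
    and T_one_mor: "\<lbrakk>A \<in> Obj C; B \<in> Obj C; f \<in> Mor C A B\<rbrakk> \<Longrightarrow> fmor (T \<one>) f = f"
    and T2_one_right: "\<lbrakk>g \<in> carrier G; A \<in> Obj C\<rbrakk> \<Longrightarrow> T2 g \<one> A = Idn C (fobj (T g) A)"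
    and T2_one_left: "\<lbrakk>g \<in> carrier G; A \<in> Obj C\<rbrakk> \<Longrightarrow> T2 \<one> g A = Idn C (fobj (T g) A)"

text \<open>
  An object of the equivariantization is a pair \<open>(M, \<mu>)\<close>, where the family \<open>\<mu>\<close> indexed by \<open>H\<close>
  is represented by the function on the whole type that is \<open>undefined\<close> outside \<open>H\<close>.
\<close>

definition equivariantization ::
  "('g, 'a) monoid_scheme \<Rightarrow> ('o, 'm) cat \<Rightarrow> ('g \<Rightarrow> ('o, 'm) endofun) \<Rightarrow> ('g \<Rightarrow> 'g \<Rightarrow> 'o \<Rightarrow> 'm)
   \<Rightarrow> 'g set \<Rightarrow> ('o \<times> ('g \<Rightarrow> 'm), 'm) cat" where
  "equivariantization G C T T2 H = \<lparr>
     Obj = {(M, \<mu>). M \<in> Obj C \<and> \<mu> \<in> extensional H \<and>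
       (\<forall>h\<in>H. is_iso C (fobj (T h) M) M (\<mu> h)) \<and>
       (\<forall>g\<in>H. \<forall>h\<in>H. \<mu> g \<cdot>\<^bsub>C\<^esub> fmor (T g) (\<mu> h) = \<mu> (g \<otimes>\<^bsub>G\<^esub> h) \<cdot>\<^bsub>C\<^esub> T2 g h M) \<and>
       \<mu> \<one>\<^bsub>G\<^esub> = Idn C M},
     Mor = (\<lambda>(M, \<mu>) (N, \<nu>).
       {f \<in> Mor C M N. \<forall>h\<in>H. \<nu> h \<cdot>\<^bsub>C\<^esub> fmor (T h) f = f \<cdot>\<^bsub>C\<^esub> \<mu> h}),
     Idn = (\<lambda>(M, \<mu>). Idn C M),
     Cmp = Cmp C,
     Pls = Pls C,
     Zro = (\<lambda>(M, \<mu>) (N, \<nu>). Zro C M N)\<rparr>"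

definition Res :: "'g set \<Rightarrow> 'o \<times> ('g \<Rightarrow> 'm) \<Rightarrow> 'o \<times> ('g \<Rightarrow> 'm)" where
  "Res B = (\<lambda>(M, \<mu>). (M, restrict \<mu> B))"

definition left_coset_reps :: "('g, 'a) monoid_scheme \<Rightarrow> 'g set \<Rightarrow> 'g set \<Rightarrow> 'g set \<Rightarrow> bool" where
  "left_coset_reps G A B R \<longleftrightarrow> R \<subseteq> A \<and> (\<forall>a\<in>A. \<exists>!r. r \<in> R \<and> a \<in> r <#\<^bsub>G\<^esub> B)"

definition double_coset_reps :: "('g, 'a) monoid_scheme \<Rightarrow> 'g set \<Rightarrow> 'g set \<Rightarrow> 'g set \<Rightarrow> bool" where
  "double_coset_reps G K H D \<longleftrightarrow> D \<subseteq> carrier G \<and>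
     (\<forall>g\<in>carrier G. \<exists>!x. x \<in> D \<and> g \<in> (K #>\<^bsub>G\<^esub> x) <#>\<^bsub>G\<^esub> H)"

text \<open>
  In \<open>Ind\<close>, the map \<open>\<nu> g\<close> is determined by its composites with the injections
  \<open>fmor (T g) (\<iota> t)\<close>, which exhibit \<open>T g P\<close> as the direct sum of the \<open>T g (T t V)\<close>.
\<close>

definition Ind ::
  "('g, 'a) monoid_scheme \<Rightarrow> ('o, 'm) cat \<Rightarrow> ('g \<Rightarrow> ('o, 'm) endofun) \<Rightarrow> ('g \<Rightarrow> 'g \<Rightarrow> 'o \<Rightarrow> 'm)
   \<Rightarrow> 'g set \<Rightarrow> 'g set \<Rightarrow> 'g set \<Rightarrow> 'o \<times> ('g \<Rightarrow> 'm) \<Rightarrow> 'o \<times> ('g \<Rightarrow> 'm)" where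
  "Ind G C T T2 A B R = (\<lambda>(V, \<mu>).
     let F = (\<lambda>t. fobj (T t) V); P = dsum_obj C R F; \<iota> = dsum_inj C R F
     in (P, \<lambda>g\<in>A. THE \<nu>. \<nu> \<in> Mor C (fobj (T g) P) P \<and>
           (\<forall>t\<in>R. \<forall>s\<in>R. \<forall>b\<in>B. g \<otimes>\<^bsub>G\<^esub> t = s \<otimes>\<^bsub>G\<^esub> b \<longrightarrow>
              \<nu> \<cdot>\<^bsub>C\<^esub> fmor (T g) (\<iota> t) =
              \<iota> s \<cdot>\<^bsub>C\<^esub> (fmor (T s) (\<mu> b) \<cdot>\<^bsub>C\<^esub>
                inverse_mor C (fobj (T s) (fobj (T b) V)) (fobj (T (s \<otimes>\<^bsub>G\<^esub> b)) V) (T2 s b V) \<cdot>\<^bsub>C\<^esub>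
                T2 g t V))))"

definition conj_subgroup :: "('g, 'a) monoid_scheme \<Rightarrow> 'g \<Rightarrow> 'g set \<Rightarrow> 'g set" where
  "conj_subgroup G x H = (x <#\<^bsub>G\<^esub> H) #>\<^bsub>G\<^esub> (inv\<^bsub>G\<^esub> x)"

definition Conj ::
  "('g, 'a) monoid_scheme \<Rightarrow> ('o, 'm) cat \<Rightarrow> ('g \<Rightarrow> ('o, 'm) endofun) \<Rightarrow> ('g \<Rightarrow> 'g \<Rightarrow> 'o \<Rightarrow> 'm)
   \<Rightarrow> 'g set \<Rightarrow> 'g \<Rightarrow> 'o \<times> ('g \<Rightarrow> 'm) \<Rightarrow> 'o \<times> ('g \<Rightarrow> 'm)" where
  "Conj G C T T2 H x = (\<lambda>(V, \<mu>).
     (fobj (T x) V,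
      \<lambda>y\<in>conj_subgroup G x H. let h = inv\<^bsub>G\<^esub> x \<otimes>\<^bsub>G\<^esub> y \<otimes>\<^bsub>G\<^esub> x in
        fmor (T x) (\<mu> h) \<cdot>\<^bsub>C\<^esub>
        inverse_mor C (fobj (T x) (fobj (T h) V)) (fobj (T (x \<otimes>\<^bsub>G\<^esub> h)) V) (T2 x h V) \<cdot>\<^bsub>C\<^esub>
        T2 y x V))"

end

theory Submission
  imports Defs
begin

text \<open>
  The injections \<open>\<iota> t\<close> of \<open>P = Ind\<^sub>H\<^sup>G(V, \<mu>)\<close> extend to morphisms \<open>\<iota> g : T\<^sup>g(V) \<rightarrow> P\<close> for all
  \<open>g \<in> G\<close> with \<open>\<iota>(gh) T\<^sub>2 = \<iota>(g) T\<^sup>g(\<mu>\<^sup>h)\<close> and \<open>\<nu>\<^sup>g T\<^sup>g(\<iota> t) = \<iota>(gt) T\<^sub>2\<close>; hence \<open>P\<close> is the direct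
  sum of the \<open>T\<^sup>r(V)\<close> via the \<open>\<iota> r\<close>, with \<open>r\<close> ranging over any system of representatives of \<open>G/H\<close>.
  For \<open>x \<in> D\<close> the morphism \<open>\<iota> x\<close> is equivariant for \<open>K \<inter> xHx\<^sup>-\<^sup>1\<close>, so by adjunction it induces a
  morphism \<open>j x\<close> in \<open>C\<^sup>K\<close> from the summand indexed by \<open>x\<close> to \<open>P\<close>. Since the products \<open>t x\<close> with
  \<open>x \<in> D\<close> and \<open>t \<in> S x\<close> represent \<open>G/H\<close>, the \<open>j x\<close> exhibit \<open>P\<close> as a direct sum in \<open>C\<close>. As they are
  equivariant, so are the corresponding projections, and \<open>P\<close> is a direct sum in \<open>C\<^sup>K\<close>. Direct sums
  in the preadditive category \<open>C\<^sup>K\<close> are unique up to isomorphism.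
\<close>

text \<open>Homomorphisms commute with finite products. Composition with a fixed morphism and the
  action of an additive functor on hom-sets are homomorphisms of hom groups, so both will distribute
  over finite sums of morphisms. Over an infinite index set \<open>finprod\<close> takes the unit as
  its default value on both sides.\<close>

lemma hom_finprod:
  assumes "comm_group G" "comm_group H" and h: "h \<in> hom G H" and f: "f \<in> I \<rightarrow> carrier G"
  shows "h (finprod G f I) = finprod H (\<lambda>i. h (f i)) I"
proof -
  interpret G: comm_group G by fact
  interpret H: comm_group H by fact
  interpret group_hom G H h by (unfold_locales) (rule h)
  show ?thesis
    using f
  proof (induction I rule: infinite_finite_induct)
    case (insert i I)
    then show ?case
      by (simp add: Pi_iff)
  qed simp_all
qed

section \<open>Direct sums in preadditive categories\<close>

context category
begin

text \<open>Hom-sets may overlap, so a morphism does not determine its domain and codomain. The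
  predicate carries both, including their membership in \<open>Obj C\<close>, so that all side
  conditions of the category laws travel in one fact.\<close>

definition arr :: "'m \<Rightarrow> 'o \<Rightarrow> 'o \<Rightarrow> bool"  ("\<guillemotleft>_ : _ \<rightarrow> _\<guillemotright>") where
  "\<guillemotleft>f : A \<rightarrow> B\<guillemotright> \<longleftrightarrow> A \<in> Obj C \<and> B \<in> Obj C \<and> f \<in> Mor C A B"

lemma arr_dom: "\<guillemotleft>f : A \<rightarrow> B\<guillemotright> \<Longrightarrow> A \<in> Obj C"
  and arr_cod: "\<guillemotleft>f : A \<rightarrow> B\<guillemotright> \<Longrightarrow> B \<in> Obj C"
  by (simp_all add: arr_def)

lemma arr_idn: "A \<in> Obj C \<Longrightarrow> \<guillemotleft>Idn C A : A \<rightarrow> A\<guillemotright>"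
  by (simp add: arr_def idn_in)

lemma arr_cmp: "\<guillemotleft>f : A \<rightarrow> B\<guillemotright> \<Longrightarrow> \<guillemotleft>g : B \<rightarrow> E\<guillemotright> \<Longrightarrow> \<guillemotleft>g \<cdot> f : A \<rightarrow> E\<guillemotright>"
  by (auto simp: arr_def intro: cmp_in)

lemma arr_assoc:
  "\<guillemotleft>f : A \<rightarrow> B\<guillemotright> \<Longrightarrow> \<guillemotleft>g : B \<rightarrow> E\<guillemotright> \<Longrightarrow> \<guillemotleft>h : E \<rightarrow> F\<guillemotright> \<Longrightarrow> h \<cdot> g \<cdot> f = h \<cdot> (g \<cdot> f)"
  by (auto simp: arr_def intro: cmp_assoc)

lemma arr_idn_left: "\<guillemotleft>f : A \<rightarrow> B\<guillemotright> \<Longrightarrow> Idn C B \<cdot> f = f"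
  and arr_idn_right: "\<guillemotleft>f : A \<rightarrow> B\<guillemotright> \<Longrightarrow> f \<cdot> Idn C A = f"
  by (auto simp: arr_def intro: idn_left idn_right)

text \<open>The inverse is an explicit argument, so that composites and images under functors come
  with their inverses.\<close>

definition iso_pair :: "'o \<Rightarrow> 'o \<Rightarrow> 'm \<Rightarrow> 'm \<Rightarrow> bool" where
  "iso_pair A B f g \<longleftrightarrow> \<guillemotleft>f : A \<rightarrow> B\<guillemotright> \<and> \<guillemotleft>g : B \<rightarrow> A\<guillemotright> \<and> g \<cdot> f = Idn C A \<and> f \<cdot> g = Idn C B"

lemma is_iso_iff: "A \<in> Obj C \<Longrightarrow> B \<in> Obj C \<Longrightarrow> is_iso C A B f \<longleftrightarrow> (\<exists>g. iso_pair A B f g)"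
  by (auto simp: is_iso_def iso_pair_def arr_def)

lemma iso_pair_sym: "iso_pair A B f g \<Longrightarrow> iso_pair B A g f"
  by (auto simp: iso_pair_def)

lemma iso_pair_cancel_right:
  assumes "iso_pair A B f g" and u: "\<guillemotleft>u : B \<rightarrow> E\<guillemotright>" and v: "\<guillemotleft>v : B \<rightarrow> E\<guillemotright>" and "u \<cdot> f = v \<cdot> f"
  shows "u = v"
proof -
  have f: "\<guillemotleft>f : A \<rightarrow> B\<guillemotright>" and g: "\<guillemotleft>g : B \<rightarrow> A\<guillemotright>" and fg: "f \<cdot> g = Idn C B"
    using assms by (auto simp: iso_pair_def)
  have "u \<cdot> f \<cdot> g = v \<cdot> f \<cdot> g" using assms by simp
  then show ?thesis
    by (simp add: arr_assoc[OF g f u] arr_assoc[OF g f v] fg arr_idn_right[OF u] arr_idn_right[OF v])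
qed

lemma iso_pair_cancel_left:
  assumes "iso_pair A B f g" and u: "\<guillemotleft>u : E \<rightarrow> A\<guillemotright>" and v: "\<guillemotleft>v : E \<rightarrow> A\<guillemotright>" and "f \<cdot> u = f \<cdot> v"
  shows "u = v"
proof -
  have f: "\<guillemotleft>f : A \<rightarrow> B\<guillemotright>" and g: "\<guillemotleft>g : B \<rightarrow> A\<guillemotright>" and gf: "g \<cdot> f = Idn C A"
    using assms by (auto simp: iso_pair_def)
  have "g \<cdot> f \<cdot> u = g \<cdot> f \<cdot> v"
    using assms by (simp add: arr_assoc[OF u f g] arr_assoc[OF v f g])
  then show ?thesis
    by (simp add: gf arr_idn_left[OF u] arr_idn_left[OF v])
qed

lemma iso_pair_unique:
  assumes "iso_pair A B f g" "iso_pair A B f g'"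
  shows "g = g'"
  by (rule iso_pair_cancel_left[OF assms(1), of _ B]) (use assms in \<open>simp_all add: iso_pair_def\<close>)

lemma iso_pair_cmp:
  assumes "iso_pair A B f f'" "iso_pair B E g g'"
  shows "iso_pair A E (g \<cdot> f) (f' \<cdot> g')"
proof -
  have a: "\<guillemotleft>f : A \<rightarrow> B\<guillemotright>" "\<guillemotleft>f' : B \<rightarrow> A\<guillemotright>" "\<guillemotleft>g : B \<rightarrow> E\<guillemotright>" "\<guillemotleft>g' : E \<rightarrow> B\<guillemotright>"
    and e: "f' \<cdot> f = Idn C A" "f \<cdot> f' = Idn C B" "g' \<cdot> g = Idn C B" "g \<cdot> g' = Idn C E"
    using assms by (auto simp: iso_pair_def)
  have "f' \<cdot> g' \<cdot> (g \<cdot> f) = f' \<cdot> (g' \<cdot> g \<cdot> f)"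
    using a arr_cmp[OF a(1,3)] by (simp add: arr_assoc)
  moreover have "g \<cdot> f \<cdot> (f' \<cdot> g') = g \<cdot> (f \<cdot> f' \<cdot> g')"
    using a arr_cmp[OF a(4,2)] by (simp add: arr_assoc)
  ultimately show ?thesis
    using a e by (auto simp: iso_pair_def arr_idn_left intro: arr_cmp)
qed

text \<open>Inverses are unique, so the \<open>THE\<close> in \<open>inverse_mor\<close> denotes a
  genuine inverse. This gives access to the inverses of \<open>T2\<close> in \<open>Ind\<close> and
  \<open>Conj\<close>.\<close>

lemma inverse_mor_iso_pair:
  assumes "is_iso C A B f" "A \<in> Obj C" "B \<in> Obj C"
  shows "iso_pair A B f (inverse_mor C A B f)"
proof -
  obtain g where g: "iso_pair A B f g"
    using assms is_iso_iff by blast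
  have "inverse_mor C A B f = g"
    unfolding inverse_mor_def
  proof (rule the_equality)
    show "g \<in> Mor C B A \<and> g \<cdot> f = Idn C A \<and> f \<cdot> g = Idn C B"
      using g by (auto simp: iso_pair_def arr_def)
    fix g' assume "g' \<in> Mor C B A \<and> g' \<cdot> f = Idn C A \<and> f \<cdot> g' = Idn C B"
    then have "iso_pair A B f g'"
      using g by (auto simp: iso_pair_def arr_def)
    then show "g' = g"
      using g iso_pair_unique by blast
  qed
  with g show ?thesis by simp
qed

end

section \<open>Sums of morphisms and direct sums\<close>

context preadditive_category
begin

abbreviation hsum :: "'a \<Rightarrow> 'a \<Rightarrow> ('i \<Rightarrow> 'b) \<Rightarrow> 'i set \<Rightarrow> 'b" where
  "hsum A B \<equiv> finprod (hom_grp C A B)"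

lemma carrier_hom_grp: "A \<in> Obj C \<Longrightarrow> B \<in> Obj C \<Longrightarrow> f \<in> carrier (hom_grp C A B) \<longleftrightarrow> \<guillemotleft>f : A \<rightarrow> B\<guillemotright>"
  by (simp add: hom_grp_def arr_def)

lemma arr_zero: "A \<in> Obj C \<Longrightarrow> B \<in> Obj C \<Longrightarrow> \<guillemotleft>Zro C A B : A \<rightarrow> B\<guillemotright>"
proof -
  assume "A \<in> Obj C" "B \<in> Obj C"
  then interpret comm_group "hom_grp C A B" by (rule hom_comm_group)
  show ?thesis
    using one_closed \<open>A \<in> Obj C\<close> \<open>B \<in> Obj C\<close> by (simp add: hom_grp_def arr_def)
qed

lemma arr_hsum:
  assumes "A \<in> Obj C" "B \<in> Obj C" "\<And>i. i \<in> I \<Longrightarrow> \<guillemotleft>f i : A \<rightarrow> B\<guillemotright>"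
  shows "\<guillemotleft>hsum A B f I : A \<rightarrow> B\<guillemotright>"
proof -
  interpret comm_group "hom_grp C A B" by (rule hom_comm_group) fact+
  have "hsum A B f I \<in> carrier (hom_grp C A B)"
    by (rule finprod_closed) (use assms carrier_hom_grp in auto)
  then show ?thesis using assms carrier_hom_grp by blast
qed

lemma hom_postcomp:
  "\<guillemotleft>g : B \<rightarrow> E\<guillemotright> \<Longrightarrow> A \<in> Obj C \<Longrightarrow> (\<lambda>f. g \<cdot> f) \<in> hom (hom_grp C A B) (hom_grp C A E)"
  by (auto simp: hom_def hom_grp_def arr_def cmp_in cmp_pls_right)

lemma hom_precomp:
  "\<guillemotleft>f : A \<rightarrow> B\<guillemotright> \<Longrightarrow> E \<in> Obj C \<Longrightarrow> (\<lambda>g. g \<cdot> f) \<in> hom (hom_grp C B E) (hom_grp C A E)"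
  by (auto simp: hom_def hom_grp_def arr_def cmp_in cmp_pls_left)

lemma cmp_hsum_right:
  assumes "\<guillemotleft>g : B \<rightarrow> E\<guillemotright>" "A \<in> Obj C" "\<And>i. i \<in> I \<Longrightarrow> \<guillemotleft>f i : A \<rightarrow> B\<guillemotright>"
  shows "g \<cdot> hsum A B f I = hsum A E (\<lambda>i. g \<cdot> f i) I"
  using assms arr_dom arr_cod carrier_hom_grp
  by (intro hom_finprod hom_comm_group hom_postcomp) blast+

lemma cmp_hsum_left:
  assumes "\<guillemotleft>g : A \<rightarrow> B\<guillemotright>" "E \<in> Obj C" "\<And>i. i \<in> I \<Longrightarrow> \<guillemotleft>f i : B \<rightarrow> E\<guillemotright>"
  shows "hsum B E f I \<cdot> g = hsum A E (\<lambda>i. f i \<cdot> g) I"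
  using assms arr_dom arr_cod carrier_hom_grp
  by (intro hom_finprod[where h = "\<lambda>f. f \<cdot> g"] hom_comm_group hom_precomp) blast+

text \<open>The zero morphism is the empty sum, so this is distributivity of composition over a sum
  without terms.\<close>

lemma cmp_zero_right:
  assumes "\<guillemotleft>g : B \<rightarrow> E\<guillemotright>" "A \<in> Obj C"
  shows "g \<cdot> Zro C A B = Zro C A E"
  using cmp_hsum_right[OF assms, of "{}" undefined] arr_dom[OF assms(1)] arr_cod[OF assms(1)] assms(2)
  by (simp add: comm_monoid.finprod_empty[OF comm_group.axioms(1)[OF hom_comm_group]])
    (simp add: hom_grp_def)

lemma cmp_zero_left:
  assumes "\<guillemotleft>g : A \<rightarrow> B\<guillemotright>" "E \<in> Obj C"
  shows "Zro C B E \<cdot> g = Zro C A E"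
  using cmp_hsum_left[OF assms, of "{}" undefined] arr_dom[OF assms(1)] arr_cod[OF assms(1)] assms(2)
  by (simp add: comm_monoid.finprod_empty[OF comm_group.axioms(1)[OF hom_comm_group]])
    (simp add: hom_grp_def)

text \<open>Collapses the sums that arise when the relations between projections and injections are
  composed with further morphisms.\<close>

lemma hsum_delta:
  assumes "A \<in> Obj C" "B \<in> Obj C" "finite I" "j \<in> I" "\<guillemotleft>f : A \<rightarrow> B\<guillemotright>"
    "\<And>i. i \<in> I \<Longrightarrow> h i = (if i = j then f else Zro C A B)"
  shows "hsum A B h I = f"
proof -
  interpret comm_group "hom_grp C A B" by (rule hom_comm_group) fact+
  have "hsum A B h I = hsum A B (\<lambda>i. if j = i then f else \<one>\<^bsub>hom_grp C A B\<^esub>) I"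
    using assms carrier_hom_grp arr_zero by (intro finprod_cong') (auto simp: hom_grp_def arr_def)
  also have "\<dots> = f"
    using assms carrier_hom_grp finprod_singleton[of j I "\<lambda>_. f"] by auto
  finally show ?thesis .
qed

lemma direct_sumD:
  assumes "is_direct_sum C I F P \<iota> \<pi>"
  shows "finite I" "P \<in> Obj C" "i \<in> I \<Longrightarrow> \<guillemotleft>\<iota> i : F i \<rightarrow> P\<guillemotright>" "i \<in> I \<Longrightarrow> \<guillemotleft>\<pi> i : P \<rightarrow> F i\<guillemotright>"
    "i \<in> I \<Longrightarrow> F i \<in> Obj C"
    "i \<in> I \<Longrightarrow> j \<in> I \<Longrightarrow> \<pi> j \<cdot> \<iota> i = (if i = j then Idn C (F i) else Zro C (F i) (F j))"
    "hsum P P (\<lambda>i. \<iota> i \<cdot> \<pi> i) I = Idn C P"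
  using assms by (auto simp: is_direct_sum_def arr_def)

text \<open>Expanding \<open>Idn C P\<close> as the sum of the
  \<open>\<iota> i \<cdot> \<pi> i\<close> writes every morphism out of \<open>P\<close> as a sum
  that depends only on its composites with the injections. Hence the injections are jointly epic;
  nearly all later equations of morphisms are tested this way.\<close>

lemma direct_sum_ext:
  assumes "is_direct_sum C I F P \<iota> \<pi>" and f: "\<guillemotleft>f : P \<rightarrow> N\<guillemotright>" and g: "\<guillemotleft>g : P \<rightarrow> N\<guillemotright>"
    and eq: "\<And>i. i \<in> I \<Longrightarrow> f \<cdot> \<iota> i = g \<cdot> \<iota> i"
  shows "f = g"
proof -
  note D = direct_sumD[OF assms(1)]
  have exp: "u = hsum P N (\<lambda>i. u \<cdot> \<iota> i \<cdot> \<pi> i) I" if u: "\<guillemotleft>u : P \<rightarrow> N\<guillemotright>" for u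
  proof -
    interpret comm_group "hom_grp C P N" by (rule hom_comm_group) (use u arr_dom arr_cod in auto)
    have "u = u \<cdot> hsum P P (\<lambda>i. \<iota> i \<cdot> \<pi> i) I"
      using D(7) u by (simp add: arr_idn_right)
    also have "\<dots> = hsum P N (\<lambda>i. u \<cdot> (\<iota> i \<cdot> \<pi> i)) I"
      using u D by (intro cmp_hsum_right) (auto intro: arr_cmp)
    also have "\<dots> = hsum P N (\<lambda>i. u \<cdot> \<iota> i \<cdot> \<pi> i) I"
      using u D arr_dom[OF u] arr_cod[OF u]
      by (intro finprod_cong')
        (auto simp: carrier_hom_grp arr_assoc[OF D(4) D(3) u] intro: arr_cmp[OF arr_cmp[OF D(4) D(3)] u])
    finally show ?thesis .
  qed
  interpret comm_group "hom_grp C P N" by (rule hom_comm_group) (use f arr_dom arr_cod in auto)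
  have "hsum P N (\<lambda>i. f \<cdot> \<iota> i \<cdot> \<pi> i) I = hsum P N (\<lambda>i. g \<cdot> \<iota> i \<cdot> \<pi> i) I"
    using f g D arr_dom[OF g] arr_cod[OF g] 
    by (intro finprod_cong') (auto simp: carrier_hom_grp eq intro: arr_cmp[OF D(4) arr_cmp[OF D(3) g]])
  then show ?thesis
    using exp[OF f] exp[OF g] by simp
qed

text \<open>Trades the sum formula in the definition for \<open>ext\<close>, which is easier to
  check: \<open>ext\<close> is applied to the sum of the \<open>\<iota> i \<cdot> \<pi> i\<close>,
  which fixes every injection by the delta relations.\<close>

lemma direct_sumI:
  assumes fin: "finite I" and P: "P \<in> Obj C"
    and \<iota>: "\<And>i. i \<in> I \<Longrightarrow> \<guillemotleft>\<iota> i : F i \<rightarrow> P\<guillemotright>" and \<pi>: "\<And>i. i \<in> I \<Longrightarrow> \<guillemotleft>\<pi> i : P \<rightarrow> F i\<guillemotright>"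
    and delta: "\<And>i j. i \<in> I \<Longrightarrow> j \<in> I \<Longrightarrow>
      \<pi> j \<cdot> \<iota> i = (if i = j then Idn C (F i) else Zro C (F i) (F j))"
    and ext: "\<And>f. \<guillemotleft>f : P \<rightarrow> P\<guillemotright> \<Longrightarrow> (\<And>i. i \<in> I \<Longrightarrow> f \<cdot> \<iota> i = \<iota> i) \<Longrightarrow> f = Idn C P"
  shows "is_direct_sum C I F P \<iota> \<pi>"
proof -
  have F: "F i \<in> Obj C" if "i \<in> I" for i using \<iota>[OF that] arr_dom by blast
  have "hsum P P (\<lambda>i. \<iota> i \<cdot> \<pi> i) I = Idn C P"
  proof (rule ext)
    show "\<guillemotleft>hsum P P (\<lambda>i. \<iota> i \<cdot> \<pi> i) I : P \<rightarrow> P\<guillemotright>"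
      using P \<iota> \<pi> by (intro arr_hsum) (auto intro: arr_cmp)
    fix j assume j: "j \<in> I"
    have "hsum P P (\<lambda>i. \<iota> i \<cdot> \<pi> i) I \<cdot> \<iota> j = hsum (F j) P (\<lambda>i. \<iota> i \<cdot> \<pi> i \<cdot> \<iota> j) I"
      using P \<iota> \<pi> j by (intro cmp_hsum_left) (auto intro: arr_cmp)
    also have "\<dots> = \<iota> j"
    proof (rule hsum_delta[OF F[OF j] P fin j \<iota>[OF j]])
      fix i assume i: "i \<in> I"
      show "\<iota> i \<cdot> \<pi> i \<cdot> \<iota> j = (if i = j then \<iota> j else Zro C (F j) P)"
        using i j by (simp add: arr_assoc[OF \<iota>[OF j] \<pi>[OF i] \<iota>[OF i]] delta F
            arr_idn_right[OF \<iota>] cmp_zero_right[OF \<iota>])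
    qed
    finally show "hsum P P (\<lambda>i. \<iota> i \<cdot> \<pi> i) I \<cdot> \<iota> j = \<iota> j" .
  qed
  then show ?thesis
    using assms(1-5) F by (auto simp: is_direct_sum_def arr_def)
qed

text \<open>Families are total functions whose values off \<open>I\<close> are arbitrary; this
  allows the injections to be exchanged for a family that agrees with them on \<open>I\<close>
  only.\<close>

lemma direct_sum_cong:
  assumes P: "is_direct_sum C I F P \<iota> \<pi>" and eq: "\<And>i. i \<in> I \<Longrightarrow> \<kappa> i = \<iota> i"
  shows "is_direct_sum C I F P \<kappa> \<pi>"
  using direct_sumD[OF P]
  by (intro direct_sumI direct_sum_ext[OF P _ arr_idn]) (simp_all add: eq arr_idn_left[OF direct_sumD(3)[OF P]])

text \<open>By the delta relations the sum of the \<open>f i \<cdot> \<pi> i\<close> restricts to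
  \<open>f j\<close> along \<open>\<iota> j\<close>. Together with \<open>direct_sum_ext\<close>
  this is the universal property of a coproduct.\<close>

lemma direct_sum_copair:
  assumes "is_direct_sum C I F P \<iota> \<pi>" and N: "N \<in> Obj C" and f: "\<And>i. i \<in> I \<Longrightarrow> \<guillemotleft>f i : F i \<rightarrow> N\<guillemotright>"
  obtains u where "\<guillemotleft>u : P \<rightarrow> N\<guillemotright>" "\<And>i. i \<in> I \<Longrightarrow> u \<cdot> \<iota> i = f i"
proof
  note D = direct_sumD[OF assms(1)]
  show "\<guillemotleft>hsum P N (\<lambda>i. f i \<cdot> \<pi> i) I : P \<rightarrow> N\<guillemotright>"
    using D N f by (intro arr_hsum) (auto intro: arr_cmp[OF D(4)])
  fix j assume j: "j \<in> I"
  have "hsum P N (\<lambda>i. f i \<cdot> \<pi> i) I \<cdot> \<iota> j = hsum (F j) N (\<lambda>i. f i \<cdot> \<pi> i \<cdot> \<iota> j) I"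
    using D N f j by (intro cmp_hsum_left) (auto intro: arr_cmp[OF D(4)])
  also have "\<dots> = f j"
  proof (rule hsum_delta[OF D(5)[OF j] N D(1) j f[OF j]])
    fix i assume i: "i \<in> I"
    show "f i \<cdot> \<pi> i \<cdot> \<iota> j = (if i = j then f j else Zro C (F j) N)"
      using i j by (simp add: arr_assoc[OF D(3)[OF j] D(4)[OF i] f[OF i]] D(5,6)
          arr_idn_right[OF f] cmp_zero_right[OF f])
  qed
  finally show "hsum P N (\<lambda>i. f i \<cdot> \<pi> i) I \<cdot> \<iota> j = f j" .
qed

text \<open>Copairing each family of injections gives morphisms in both directions; their composites
  fix the injections and so are identities.\<close>

lemma direct_sum_isomorphic:
  assumes P: "is_direct_sum C I F P \<iota> \<pi>" and Q: "is_direct_sum C I F Q \<kappa> \<rho>"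
  shows "isomorphic C P Q"
proof -
  note DP = direct_sumD[OF P] and DQ = direct_sumD[OF Q]
  obtain u where u: "\<guillemotleft>u : P \<rightarrow> Q\<guillemotright>" "\<And>i. i \<in> I \<Longrightarrow> u \<cdot> \<iota> i = \<kappa> i"
    using direct_sum_copair[OF P DQ(2), of \<kappa>] DQ(3) by blast
  obtain v where v: "\<guillemotleft>v : Q \<rightarrow> P\<guillemotright>" "\<And>i. i \<in> I \<Longrightarrow> v \<cdot> \<kappa> i = \<iota> i"
    using direct_sum_copair[OF Q DP(2), of \<iota>] DP(3) by blast
  have "v \<cdot> u = Idn C P"
    using u v DP
    by (intro direct_sum_ext[OF P arr_cmp[OF u(1) v(1)] arr_idn])
      (auto simp: arr_assoc[OF DP(3) u(1) v(1)] arr_idn_left[OF DP(3)])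
  moreover have "u \<cdot> v = Idn C Q"
    using u v DQ
    by (intro direct_sum_ext[OF Q arr_cmp[OF v(1) u(1)] arr_idn])
      (auto simp: arr_assoc[OF DQ(3) v(1) u(1)] arr_idn_left[OF DQ(3)])
  ultimately show ?thesis
    using u(1) v(1) by (auto simp: isomorphic_def is_iso_def arr_def)
qed

text \<open>Serves two purposes: exchanging one system of coset representatives for another, and
  replacing \<open>T (t \<otimes> x)\<close> by \<open>T t\<close> after \<open>T x\<close> on the
  summands.\<close>

lemma direct_sum_reindex:
  assumes P: "is_direct_sum C I F P \<iota> \<pi>" and \<sigma>: "bij_betw \<sigma> J I"
    and e: "\<And>j. j \<in> J \<Longrightarrow> iso_pair (F' j) (F (\<sigma> j)) (e j) (e' j)"
  shows "is_direct_sum C J F' P (\<lambda>j. \<iota> (\<sigma> j) \<cdot> e j) (\<lambda>j. e' j \<cdot> \<pi> (\<sigma> j))"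
proof (rule direct_sumI)
  note D = direct_sumD[OF P]
  have \<sigma>I: "\<sigma> j \<in> I" if "j \<in> J" for j using \<sigma> that by (auto simp: bij_betw_def)
  note \<iota> = D(3)[OF \<sigma>I] and \<pi> = D(4)[OF \<sigma>I]
  have e1: "\<guillemotleft>e j : F' j \<rightarrow> F (\<sigma> j)\<guillemotright>" and e2: "\<guillemotleft>e' j : F (\<sigma> j) \<rightarrow> F' j\<guillemotright>"
    and e3: "e' j \<cdot> e j = Idn C (F' j)" "e j \<cdot> e' j = Idn C (F (\<sigma> j))" if "j \<in> J" for j
    using e[OF that] by (auto simp: iso_pair_def)
  show "finite J" using \<sigma> D(1) bij_betw_finite by blast
  show "P \<in> Obj C" by fact
  show "\<guillemotleft>\<iota> (\<sigma> j) \<cdot> e j : F' j \<rightarrow> P\<guillemotright>" if "j \<in> J" for j using that \<iota> e1 by (blast intro: arr_cmp)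
  show "\<guillemotleft>e' j \<cdot> \<pi> (\<sigma> j) : P \<rightarrow> F' j\<guillemotright>" if "j \<in> J" for j using that \<pi> e2 by (blast intro: arr_cmp)
  show "e' k \<cdot> \<pi> (\<sigma> k) \<cdot> (\<iota> (\<sigma> j) \<cdot> e j) = (if j = k then Idn C (F' j) else Zro C (F' j) (F' k))"
    if j: "j \<in> J" and k: "k \<in> J" for j k
  proof -
    have "e' k \<cdot> \<pi> (\<sigma> k) \<cdot> (\<iota> (\<sigma> j) \<cdot> e j) = e' k \<cdot> (\<pi> (\<sigma> k) \<cdot> \<iota> (\<sigma> j) \<cdot> e j)"
      using arr_assoc[OF arr_cmp[OF e1[OF j] \<iota>[OF j]] \<pi>[OF k] e2[OF k]]
        arr_assoc[OF e1[OF j] \<iota>[OF j] \<pi>[OF k]] by simp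
    \<comment> \<open>Injectivity of \<open>\<sigma>\<close> on \<open>J\<close> turns the condition
      \<open>\<sigma> j = \<sigma> k\<close> into \<open>j = k\<close>.\<close>
    also have "\<pi> (\<sigma> k) \<cdot> \<iota> (\<sigma> j) = (if j = k then Idn C (F (\<sigma> j)) else Zro C (F (\<sigma> j)) (F (\<sigma> k)))"
      using D(6)[OF \<sigma>I[OF j] \<sigma>I[OF k]] \<sigma> j k by (auto simp: bij_betw_def inj_on_def)
    finally show ?thesis
      using arr_idn_left[OF e1[OF j]] e3(1)[OF j] cmp_zero_left[OF e1[OF j]] D(5)[OF \<sigma>I[OF k]]
        cmp_zero_right[OF e2[OF k] arr_dom[OF e1[OF j]]] by auto
  qed
  fix f assume f: "\<guillemotleft>f : P \<rightarrow> P\<guillemotright>" and eq: "\<And>j. j \<in> J \<Longrightarrow> f \<cdot> (\<iota> (\<sigma> j) \<cdot> e j) = \<iota> (\<sigma> j) \<cdot> e j"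
  show "f = Idn C P"
  proof (rule direct_sum_ext[OF P f arr_idn[OF D(2)]])
    fix i assume "i \<in> I"
    then obtain j where j: "j \<in> J" "i = \<sigma> j" using \<sigma> by (auto simp: bij_betw_def)
    have "f \<cdot> \<iota> i = \<iota> i"
      by (rule iso_pair_cancel_right[OF e[OF j(1)]])
        (use eq[OF j(1)] j arr_assoc[OF e1[OF j(1)] \<iota>[OF j(1)] f] \<iota>[OF j(1)]
          arr_cmp[OF \<iota>[OF j(1)] f] in auto)
    then show "f \<cdot> \<iota> i = Idn C P \<cdot> \<iota> i"
      using j \<iota> arr_idn_left by metis
  qed
qed

text \<open>Regroups a direct sum over pairs into blocks. The morphisms \<open>j x\<close> are
  prescribed, because they will be the equivariant ones supplied by adjunction; only the projections
  onto the blocks have to be found.\<close>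

lemma direct_sum_assoc:
  assumes P: "is_direct_sum C (Sigma D S) F P \<iota> \<pi>" and D: "finite D"
    and Q: "\<And>x. x \<in> D \<Longrightarrow> is_direct_sum C (S x) (\<lambda>t. F (x, t)) (Q x) (\<kappa> x) (\<rho> x)"
    and j: "\<And>x. x \<in> D \<Longrightarrow> \<guillemotleft>j x : Q x \<rightarrow> P\<guillemotright>"
    and jk: "\<And>x t. x \<in> D \<Longrightarrow> t \<in> S x \<Longrightarrow> j x \<cdot> \<kappa> x t = \<iota> (x, t)"
  shows "\<exists>p. is_direct_sum C D Q P j p"
proof -
  note DP = direct_sumD[OF P] and DQ = direct_sumD[OF Q]
  \<comment> \<open>The projection to the block of \<open>x\<close> is defined by copairing: the
    injections \<open>\<kappa> x t\<close> on that block and zero on all other blocks.\<close>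
  have "\<exists>u. \<guillemotleft>u : P \<rightarrow> Q x\<guillemotright> \<and> (\<forall>i\<in>Sigma D S.
    u \<cdot> \<iota> i = (if fst i = x then \<kappa> x (snd i) else Zro C (F i) (Q x)))" if x: "x \<in> D" for x
  proof -
    have "\<guillemotleft>if fst i = x then \<kappa> x (snd i) else Zro C (F i) (Q x) : F i \<rightarrow> Q x\<guillemotright>"
      if "i \<in> Sigma D S" for i
      using that x DQ(2,3)[OF x] DP(5)[OF that] by (auto intro: arr_zero)
    from direct_sum_copair[OF P DQ(2)[OF x] this] show ?thesis by metis
  qed
  then obtain p where p: "\<And>x. x \<in> D \<Longrightarrow> \<guillemotleft>p x : P \<rightarrow> Q x\<guillemotright>"
    and pi: "\<And>x y t. x \<in> D \<Longrightarrow> y \<in> D \<Longrightarrow> t \<in> S y \<Longrightarrow>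
      p x \<cdot> \<iota> (y, t) = (if y = x then \<kappa> x t else Zro C (F (y, t)) (Q x))"
    by (metis (no_types, lifting) SigmaI fst_conv snd_conv)
  have "is_direct_sum C D Q P j p"
  proof (rule direct_sumI[OF D DP(2) j p])
    fix x y assume x: "x \<in> D" and y: "y \<in> D"
    show "p y \<cdot> j x = (if x = y then Idn C (Q x) else Zro C (Q x) (Q y))"
    proof (rule direct_sum_ext[OF Q[OF x] arr_cmp[OF j[OF x] p[OF y]]])
      show "\<guillemotleft>if x = y then Idn C (Q x) else Zro C (Q x) (Q y) : Q x \<rightarrow> Q y\<guillemotright>"
        using DQ(2) x y by (auto intro: arr_idn arr_zero)
      fix t assume t: "t \<in> S x"
      have "p y \<cdot> j x \<cdot> \<kappa> x t = (if x = y then \<kappa> x t else Zro C (F (x, t)) (Q y))"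
        using arr_assoc[OF DQ(3)[OF x t] j[OF x] p[OF y]] jk[OF x t] pi[OF y x t] by simp
      then show "p y \<cdot> j x \<cdot> \<kappa> x t = (if x = y then Idn C (Q x) else Zro C (Q x) (Q y)) \<cdot> \<kappa> x t"
        using arr_idn_left[OF DQ(3)[OF x t]] cmp_zero_left[OF DQ(3)[OF x t] DQ(2)[OF y]] by auto
    qed
  next
    fix f assume f: "\<guillemotleft>f : P \<rightarrow> P\<guillemotright>" and eq: "\<And>x. x \<in> D \<Longrightarrow> f \<cdot> j x = j x"
    show "f = Idn C P"
    proof (rule direct_sum_ext[OF P f arr_idn[OF DP(2)]])
      fix i assume i: "i \<in> Sigma D S"
      then obtain x t where xt: "i = (x, t)" "x \<in> D" "t \<in> S x" by auto
      then show "f \<cdot> \<iota> i = Idn C P \<cdot> \<iota> i"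
        using arr_assoc[OF DQ(3)[OF xt(2,3)] j[OF xt(2)] f] jk[OF xt(2,3)] eq[OF xt(2)]
          arr_idn_left[OF DP(3)[OF i]] by simp
    qed
  qed
  then show ?thesis by blast
qed

end

section \<open>Existence of finite direct sums\<close>

context abelian_category
begin

lemma ex_direct_sum:
  assumes "finite I" "\<And>i. i \<in> I \<Longrightarrow> F i \<in> Obj C"
  shows "\<exists>P \<iota> \<pi>. is_direct_sum C I F P \<iota> \<pi>"
  using assms
proof (induction I rule: finite_induct)
  case empty
  obtain Z where Z: "is_zero_object C Z" using ex_zero_object by blast
  then have ZO: "Z \<in> Obj C" by (simp add: is_zero_object_def)
  \<comment> \<open>Without summands the families are irrelevant. What remains is that an
    endomorphism of a zero object is the identity, by uniqueness.\<close>
  have "is_direct_sum C {} F Z undefined undefined"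
  proof (rule direct_sumI)
    fix f assume "\<guillemotleft>f : Z \<rightarrow> Z\<guillemotright>"
    then show "f = Idn C Z"
      using Z arr_idn[OF ZO] unfolding is_zero_object_def arr_def by blast
  qed (use ZO in auto)
  then show ?case by blast
next
  case (insert a I)
  then obtain P \<iota> \<pi> where P: "is_direct_sum C I F P \<iota> \<pi>" by auto
  note DP = direct_sumD[OF P]
  obtain Q \<kappa> \<rho> where Q: "is_direct_sum C UNIV (\<lambda>i::bool. if i then F a else P) Q \<kappa> \<rho>"
    using ex_binary_direct_sum[of "F a" P] insert.prems DP(2) by blast
  note DQ = direct_sumD[OF Q, simplified]
  have k: "\<guillemotleft>\<kappa> True : F a \<rightarrow> Q\<guillemotright>" "\<guillemotleft>\<kappa> False : P \<rightarrow> Q\<guillemotright>"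
    and r: "\<guillemotleft>\<rho> True : Q \<rightarrow> F a\<guillemotright>" "\<guillemotleft>\<rho> False : Q \<rightarrow> P\<guillemotright>"
    using DQ(3,4)[of True] DQ(3,4)[of False] by simp_all
  have rk: "\<rho> True \<cdot> \<kappa> True = Idn C (F a)" "\<rho> False \<cdot> \<kappa> False = Idn C P"
    "\<rho> True \<cdot> \<kappa> False = Zro C P (F a)" "\<rho> False \<cdot> \<kappa> True = Zro C (F a) P"
    using DQ(6)[of True True] DQ(6)[of True False] DQ(6)[of False True] DQ(6)[of False False]
    by simp_all
  \<comment> \<open>The new summand is the \<open>True\<close> half of the binary sum; the old ones
    enter through \<open>P\<close>, its \<open>False\<close> half.\<close>
  let ?i = "\<lambda>i. if i = a then \<kappa> True else \<kappa> False \<cdot> \<iota> i"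
  let ?p = "\<lambda>i. if i = a then \<rho> True else \<pi> i \<cdot> \<rho> False"
  have Fa: "F a \<in> Obj C" using insert.prems by simp
  have "is_direct_sum C (insert a I) F Q ?i ?p"
  proof (rule direct_sumI)
    show "finite (insert a I)" using insert by simp
    show "Q \<in> Obj C" using DQ by simp
    show "\<guillemotleft>?i i : F i \<rightarrow> Q\<guillemotright>" if "i \<in> insert a I" for i
      using that k DP(3) by (auto intro: arr_cmp)
    show "\<guillemotleft>?p i : Q \<rightarrow> F i\<guillemotright>" if "i \<in> insert a I" for i
      using that r DP(4) by (auto intro: arr_cmp)
  next
    fix i j assume ij: "i \<in> insert a I" "j \<in> insert a I"
    consider "i = a" "j = a" | "i \<noteq> a" "j = a" "i \<in> I" | "i = a" "j \<noteq> a" "j \<in> I"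
      | "i \<noteq> a" "j \<noteq> a" "i \<in> I" "j \<in> I"
      using ij by blast
    then show "?p j \<cdot> ?i i = (if i = j then Idn C (F i) else Zro C (F i) (F j))"
    proof cases
      case 2
      then show ?thesis
        using arr_assoc[OF DP(3) k(2) r(1), of i, symmetric] rk cmp_zero_left[OF DP(3) Fa] by simp
    next
      case 3
      then show ?thesis
        using arr_assoc[OF k(1) r(2) DP(4), of j] rk cmp_zero_right[OF DP(4) Fa] by simp
    next
      case 4
      have "\<pi> j \<cdot> \<rho> False \<cdot> (\<kappa> False \<cdot> \<iota> i) = \<pi> j \<cdot> (\<rho> False \<cdot> \<kappa> False \<cdot> \<iota> i)"
        using arr_assoc[OF arr_cmp[OF DP(3) k(2)] r(2) DP(4), of i j]
          arr_assoc[OF DP(3) k(2) r(2), of i] 4 by simp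
      then show ?thesis
        using 4 rk arr_idn_left[OF DP(3)] DP(6) by simp
    qed (simp add: rk)
  next
    fix f assume f: "\<guillemotleft>f : Q \<rightarrow> Q\<guillemotright>" and eq: "\<And>i. i \<in> insert a I \<Longrightarrow> f \<cdot> ?i i = ?i i"
    \<comment> \<open>Joint epicness is used twice: first on \<open>P\<close> to get from the
      summands to \<open>\<kappa> False\<close>, then on the binary sum \<open>Q\<close>.\<close>
    have "f \<cdot> \<kappa> False = \<kappa> False"
    proof (rule direct_sum_ext[OF P arr_cmp[OF k(2) f] k(2)])
      fix i assume i: "i \<in> I"
      then have "i \<noteq> a" using insert by blast
      then show "f \<cdot> \<kappa> False \<cdot> \<iota> i = \<kappa> False \<cdot> \<iota> i"
        using eq[of i] i arr_assoc[OF DP(3) k(2) f, of i] by simp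
    qed
    moreover have "f \<cdot> \<kappa> True = \<kappa> True"
      using eq[of a] by simp
    ultimately have "f \<cdot> \<kappa> i = Idn C Q \<cdot> \<kappa> i" for i
      using arr_idn_left[OF k(1)] arr_idn_left[OF k(2)] by (cases i) simp_all
    then show "f = Idn C Q"
      by (intro direct_sum_ext[OF Q f arr_idn]) (use DQ in auto)
  qed
  then show ?case by blast
qed

end

text \<open>The choice made by \<open>SOME\<close> meets its specification once any direct sum is
  known. The statement is about an arbitrary \<open>cat\<close>, so it serves both in
  \<open>C\<close> and in an equivariantization.\<close>

lemma is_direct_sum_dsum:
  assumes "is_direct_sum C I F P \<iota> \<pi>"
  shows "\<exists>\<pi>. is_direct_sum C I F (dsum_obj C I F) (dsum_inj C I F) \<pi>"
proof -
  have "case dsum C I F of (P, \<iota>, \<pi>) \<Rightarrow> is_direct_sum C I F P \<iota> \<pi>"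
    unfolding dsum_def by (rule someI[of _ "(P, \<iota>, \<pi>)"]) (use assms in simp)
  then show ?thesis
    unfolding dsum_obj_def dsum_inj_def by (auto split: prod.splits)
qed

section \<open>Equivariant objects\<close>

locale abelian_action = group G + abelian_category C + categorical_action G C T T2
  for G :: "('g, 'a) monoid_scheme" (structure) and C :: "('o, 'm) cat"
    and T :: "'g \<Rightarrow> ('o, 'm) endofun" and T2 :: "'g \<Rightarrow> 'g \<Rightarrow> 'o \<Rightarrow> 'm"
begin

abbreviation cmpC (infixl "\<bullet>" 70) where "g \<bullet> f \<equiv> g \<cdot>\<^bsub>C\<^esub> f"

abbreviation TO :: "'g \<Rightarrow> 'o \<Rightarrow> 'o" where "TO g \<equiv> fobj (T g)"

abbreviation TM :: "'g \<Rightarrow> 'm \<Rightarrow> 'm" where "TM g \<equiv> fmor (T g)"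

abbreviation T2i :: "'g \<Rightarrow> 'g \<Rightarrow> 'o \<Rightarrow> 'm" where
  "T2i g h M \<equiv> inverse_mor C (TO g (TO h M)) (TO (g \<otimes> h) M) (T2 g h M)"

abbreviation CE :: "'g set \<Rightarrow> ('o \<times> ('g \<Rightarrow> 'm), 'm) cat" where
  "CE \<equiv> equivariantization G C T T2"

lemma T_functor: "g \<in> carrier G \<Longrightarrow> is_functor C (T g)"
  using T_autoequivalence by (simp add: is_autoequivalence_def)

lemma T_obj: "g \<in> carrier G \<Longrightarrow> A \<in> Obj C \<Longrightarrow> TO g A \<in> Obj C"
  using T_functor by (simp add: is_functor_def)

lemma T_idn: "g \<in> carrier G \<Longrightarrow> A \<in> Obj C \<Longrightarrow> TM g (Idn C A) = Idn C (TO g A)"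
  using T_functor by (simp add: is_functor_def)

lemma T_arr: "g \<in> carrier G \<Longrightarrow> \<guillemotleft>f : A \<rightarrow> B\<guillemotright> \<Longrightarrow> \<guillemotleft>TM g f : TO g A \<rightarrow> TO g B\<guillemotright>"
  using T_functor by (simp add: is_functor_def arr_def)

lemma T_cmp:
  "g \<in> carrier G \<Longrightarrow> \<guillemotleft>f : A \<rightarrow> B\<guillemotright> \<Longrightarrow> \<guillemotleft>h : B \<rightarrow> E\<guillemotright> \<Longrightarrow> TM g (h \<bullet> f) = TM g h \<bullet> TM g f"
  using T_functor[of g] by (auto simp: is_functor_def arr_def)

lemma T_one: "\<guillemotleft>f : A \<rightarrow> B\<guillemotright> \<Longrightarrow> TM \<one> f = f"
  by (auto simp: arr_def intro: T_one_mor)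

lemma T_iso_pair: "g \<in> carrier G \<Longrightarrow> iso_pair A B u v \<Longrightarrow> iso_pair (TO g A) (TO g B) (TM g u) (TM g v)"
  by (auto simp: iso_pair_def T_arr T_cmp[symmetric] T_idn arr_dom)

lemma T_hom:
  assumes "g \<in> carrier G" "A \<in> Obj C" "B \<in> Obj C"
  shows "TM g \<in> hom (hom_grp C A B) (hom_grp C (TO g A) (TO g B))"
  using T_exact[OF assms(1)] T_functor[OF assms(1)] assms(2,3)
  by (auto simp: hom_def hom_grp_def is_exact_def is_functor_def)

lemma T_zero:
  assumes "g \<in> carrier G" "A \<in> Obj C" "B \<in> Obj C"
  shows "TM g (Zro C A B) = Zro C (TO g A) (TO g B)"
proof -
  have "group (hom_grp C A B)" "group (hom_grp C (TO g A) (TO g B))"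
    using assms T_obj by (blast intro: comm_group.axioms(2) hom_comm_group)+
  then show ?thesis
    using hom_one[OF T_hom[OF assms]] by (simp add: hom_grp_def)
qed

text \<open>The equations that define a direct sum involve only composition, identities, zeros and
  sums, all preserved by \<open>T g\<close>, whose additivity is part of \<open>is_exact\<close>.
  Hence morphisms out of \<open>TO g P\<close> can be defined and compared on the
  \<open>TM g (\<iota> i)\<close>.\<close>

lemma T_direct_sum:
  assumes g: "g \<in> carrier G" and P: "is_direct_sum C I F P \<iota> \<pi>"
  shows "is_direct_sum C I (\<lambda>i. TO g (F i)) (TO g P) (\<lambda>i. TM g (\<iota> i)) (\<lambda>i. TM g (\<pi> i))"
proof -
  note D = direct_sumD[OF P]
  interpret comm_group "hom_grp C (TO g P) (TO g P)"
    by (rule hom_comm_group) (use T_obj[OF g D(2)] in auto)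
  have "hsum (TO g P) (TO g P) (\<lambda>i. TM g (\<iota> i) \<bullet> TM g (\<pi> i)) I
      = hsum (TO g P) (TO g P) (\<lambda>i. TM g (\<iota> i \<bullet> \<pi> i)) I"
    using T_arr[OF g arr_cmp[OF D(4) D(3)]] T_obj[OF g D(2)]
    by (intro finprod_cong') (auto simp: carrier_hom_grp T_cmp[OF g D(4) D(3)])
  also have "\<dots> = TM g (hsum P P (\<lambda>i. \<iota> i \<bullet> \<pi> i) I)"
    using D(2) T_obj[OF g D(2)] arr_cmp[OF D(4) D(3)]
    by (intro hom_finprod[symmetric] hom_comm_group T_hom g) (auto simp: carrier_hom_grp)
  also have "\<dots> = Idn C (TO g P)"
    using D(7) T_idn[OF g D(2)] by simp
  finally have sum: "hsum (TO g P) (TO g P) (\<lambda>i. TM g (\<iota> i) \<bullet> TM g (\<pi> i)) I = Idn C (TO g P)" .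
  have "TM g (\<pi> j) \<bullet> TM g (\<iota> i)
      = (if i = j then Idn C (TO g (F i)) else Zro C (TO g (F i)) (TO g (F j)))"
    if "i \<in> I" "j \<in> I" for i j
    using that D(5,6) g by (simp add: T_cmp[OF g D(3) D(4), symmetric] T_idn T_zero)
  then show ?thesis
    using sum D(1) T_obj[OF g D(2)] T_obj[OF g D(5)] T_arr[OF g D(3)] T_arr[OF g D(4)]
    by (simp add: is_direct_sum_def arr_def)
qed

lemma T2_iso_pair:
  assumes "g \<in> carrier G" "h \<in> carrier G" "A \<in> Obj C"
  shows "iso_pair (TO g (TO h A)) (TO (g \<otimes> h) A) (T2 g h A) (T2i g h A)"
  using T2_nat_iso[OF assms(1,2)] assms T_obj
  by (intro inverse_mor_iso_pair) (auto simp: nat_iso_def comp_fun_def)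

lemma T2_arr:
  "g \<in> carrier G \<Longrightarrow> h \<in> carrier G \<Longrightarrow> A \<in> Obj C \<Longrightarrow> \<guillemotleft>T2 g h A : TO g (TO h A) \<rightarrow> TO (g \<otimes> h) A\<guillemotright>"
  using T2_iso_pair by (simp add: iso_pair_def)

lemma T2_natural:
  "g \<in> carrier G \<Longrightarrow> h \<in> carrier G \<Longrightarrow> \<guillemotleft>f : A \<rightarrow> B\<guillemotright> \<Longrightarrow>
    T2 g h B \<bullet> TM g (TM h f) = TM (g \<otimes> h) f \<bullet> T2 g h A"
  using T2_nat_iso[of g h] by (auto simp: nat_iso_def comp_fun_def arr_def)

text \<open>Naturality of \<open>T2 (inv g) g\<close>, whose target functor is
  \<open>T \<one>\<close>, recovers \<open>u\<close> from \<open>TM (inv g) (TM g u)\<close> up to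
  an isomorphism that can be cancelled.\<close>

lemma T_faithful:
  assumes g: "g \<in> carrier G" and u: "\<guillemotleft>u : A \<rightarrow> B\<guillemotright>" and v: "\<guillemotleft>v : A \<rightarrow> B\<guillemotright>" and eq: "TM g u = TM g v"
  shows "u = v"
proof (rule iso_pair_cancel_right)
  have g': "inv g \<in> carrier G" using g by simp
  show "iso_pair (TO (inv g) (TO g A)) A (T2 (inv g) g A) (T2i (inv g) g A)"
    using T2_iso_pair[OF g' g arr_dom[OF u]] g arr_dom[OF u] by (simp add: T_one_obj)
  show "u \<bullet> T2 (inv g) g A = v \<bullet> T2 (inv g) g A"
    using T2_natural[OF g' g u] T2_natural[OF g' g v] eq g by (simp add: T_one[OF u] T_one[OF v])
qed fact+

section \<open>Objects and morphisms of the equivariantization\<close>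

lemma equi_objD:
  assumes "(M, \<mu>) \<in> Obj (CE H)" "H \<subseteq> carrier G"
  shows "M \<in> Obj C" "h \<in> H \<Longrightarrow> \<guillemotleft>\<mu> h : TO h M \<rightarrow> M\<guillemotright>"
    "g \<in> H \<Longrightarrow> h \<in> H \<Longrightarrow> \<mu> g \<bullet> TM g (\<mu> h) = \<mu> (g \<otimes> h) \<bullet> T2 g h M"
    "\<mu> \<one> = Idn C M" "\<mu> \<in> extensional H"
    "h \<in> H \<Longrightarrow> is_iso C (TO h M) M (\<mu> h)"
  using assms T_obj by (auto simp: equivariantization_def arr_def is_iso_def)

text \<open>Invertibility is derived from coherence and normalization: coherence at \<open>g\<close>
  and \<open>inv g\<close> makes \<open>r\<close> a right inverse of \<open>\<mu> g\<close>, and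
  coherence in the opposite order makes \<open>r\<close> a left inverse as well.\<close>

lemma equi_objI:
  assumes H: "subgroup H G" and M: "M \<in> Obj C" and ext: "\<mu> \<in> extensional H"
    and \<mu>: "\<And>h. h \<in> H \<Longrightarrow> \<guillemotleft>\<mu> h : TO h M \<rightarrow> M\<guillemotright>"
    and coh: "\<And>g h. g \<in> H \<Longrightarrow> h \<in> H \<Longrightarrow> \<mu> g \<bullet> TM g (\<mu> h) = \<mu> (g \<otimes> h) \<bullet> T2 g h M"
    and one: "\<mu> \<one> = Idn C M"
  shows "(M, \<mu>) \<in> Obj (CE H)"
proof -
  have "is_iso C (TO g M) M (\<mu> g)" if gH: "g \<in> H" for g
  proof -
    have g: "g \<in> carrier G" and gH': "inv g \<in> H"
      using H gH by (auto simp: subgroup.mem_carrier subgroup.m_inv_closed)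
    then have g': "inv g \<in> carrier G" by simp
    define r where "r = TM g (\<mu> (inv g)) \<bullet> T2i g (inv g) M"
    have ti: "iso_pair (TO g (TO (inv g) M)) M (T2 g (inv g) M) (T2i g (inv g) M)"
      using T2_iso_pair[OF g g' M] g M by (simp add: T_one_obj)
    have ti': "iso_pair (TO (inv g) (TO g M)) M (T2 (inv g) g M) (T2i (inv g) g M)"
      using T2_iso_pair[OF g' g M] g M by (simp add: T_one_obj)
    have a: "\<guillemotleft>\<mu> g : TO g M \<rightarrow> M\<guillemotright>" and b: "\<guillemotleft>\<mu> (inv g) : TO (inv g) M \<rightarrow> M\<guillemotright>"
      using \<mu> gH gH' by auto
    have Ta: "\<guillemotleft>TM (inv g) (\<mu> g) : TO (inv g) (TO g M) \<rightarrow> TO (inv g) M\<guillemotright>"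
      and Tb: "\<guillemotleft>TM g (\<mu> (inv g)) : TO g (TO (inv g) M) \<rightarrow> TO g M\<guillemotright>"
      using T_arr g g' a b by auto
    have i: "\<guillemotleft>T2 g (inv g) M : TO g (TO (inv g) M) \<rightarrow> M\<guillemotright>"
      "\<guillemotleft>T2i g (inv g) M : M \<rightarrow> TO g (TO (inv g) M)\<guillemotright>"
      and i': "\<guillemotleft>T2 (inv g) g M : TO (inv g) (TO g M) \<rightarrow> M\<guillemotright>"
      "\<guillemotleft>T2i (inv g) g M : M \<rightarrow> TO (inv g) (TO g M)\<guillemotright>"
      using ti ti' by (simp_all add: iso_pair_def)
    have r: "\<guillemotleft>r : M \<rightarrow> TO g M\<guillemotright>"
      unfolding r_def using arr_cmp[OF i(2) Tb] .
    have ar: "\<mu> g \<bullet> r = Idn C M"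
    proof -
      have "\<mu> g \<bullet> r = \<mu> g \<bullet> TM g (\<mu> (inv g)) \<bullet> T2i g (inv g) M"
        unfolding r_def using arr_assoc[OF i(2) Tb a] by simp
      also have "\<mu> g \<bullet> TM g (\<mu> (inv g)) = T2 g (inv g) M"
        using coh[OF gH gH'] g one arr_idn_left[OF i(1)] by simp
      also have "T2 g (inv g) M \<bullet> T2i g (inv g) M = Idn C M"
        using ti by (simp add: iso_pair_def)
      finally show ?thesis .
    qed
    have ba: "\<mu> (inv g) \<bullet> TM (inv g) (\<mu> g) = T2 (inv g) g M"
      using coh[OF gH' gH] g one arr_idn_left[OF i'(1)] by simp
    have ra: "\<guillemotleft>r \<bullet> \<mu> g : TO g M \<rightarrow> TO g M\<guillemotright>" using arr_cmp[OF a r] .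
    \<comment> \<open>The equation is tested after applying the faithful functor
      \<open>T (inv g)\<close>. By \<open>ba\<close> the invertible \<open>T2 (inv g) g M\<close>
      factors through \<open>TM (inv g) (\<mu> g)\<close>, which absorbs
      \<open>TM (inv g) (r \<bullet> \<mu> g)\<close> because \<open>\<mu> g \<bullet> r\<close> is
      the identity.\<close>
    have "r \<bullet> \<mu> g = Idn C (TO g M)"
    proof (rule T_faithful[OF g' ra arr_idn[OF T_obj[OF g M]]])
      have Tra: "\<guillemotleft>TM (inv g) (r \<bullet> \<mu> g) : TO (inv g) (TO g M) \<rightarrow> TO (inv g) (TO g M)\<guillemotright>"
        using T_arr[OF g' ra] .
      have "T2 (inv g) g M \<bullet> TM (inv g) (r \<bullet> \<mu> g)
          = \<mu> (inv g) \<bullet> (TM (inv g) (\<mu> g) \<bullet> TM (inv g) (r \<bullet> \<mu> g))"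
        using arr_assoc[OF Tra Ta b] by (simp add: ba)
      also have "TM (inv g) (\<mu> g) \<bullet> TM (inv g) (r \<bullet> \<mu> g) = TM (inv g) (\<mu> g \<bullet> (r \<bullet> \<mu> g))"
        using T_cmp[OF g' ra a] by simp
      also have "\<mu> g \<bullet> (r \<bullet> \<mu> g) = \<mu> g"
        using arr_assoc[OF a r a] ar arr_idn_left[OF a] by simp
      also have "\<mu> (inv g) \<bullet> TM (inv g) (\<mu> g) = T2 (inv g) g M" by (rule ba)
      finally have "T2 (inv g) g M \<bullet> TM (inv g) (r \<bullet> \<mu> g)
          = T2 (inv g) g M \<bullet> Idn C (TO (inv g) (TO g M))"
        using arr_idn_right[OF i'(1)] by simp
      then have "TM (inv g) (r \<bullet> \<mu> g) = Idn C (TO (inv g) (TO g M))"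
        by (rule iso_pair_cancel_left[OF ti' Tra arr_idn[OF arr_dom[OF Tra]]])
      then show "TM (inv g) (r \<bullet> \<mu> g) = TM (inv g) (Idn C (TO g M))"
        using T_idn[OF g' T_obj[OF g M]] by simp
    qed
    then show ?thesis
      using a r ar by (auto simp: is_iso_def arr_def)
  qed
  then show ?thesis
    using assms by (simp add: equivariantization_def)
qed

lemma equi_mor_iff:
  assumes "(M, \<mu>) \<in> Obj (CE H)" "(N, \<nu>) \<in> Obj (CE H)"
  shows "f \<in> Mor (CE H) (M, \<mu>) (N, \<nu>) \<longleftrightarrow> \<guillemotleft>f : M \<rightarrow> N\<guillemotright> \<and> (\<forall>h\<in>H. \<nu> h \<bullet> TM h f = f \<bullet> \<mu> h)"
  using assms by (auto simp: equivariantization_def arr_def)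

lemma equi_simps:
  "Cmp (CE H) = Cmp C" "Pls (CE H) = Pls C" "Idn (CE H) (M, \<mu>) = Idn C M"
  "Zro (CE H) (M, \<mu>) (N, \<nu>) = Zro C M N"
  by (simp_all add: equivariantization_def)

lemma equi_mor_cmp:
  assumes H: "H \<subseteq> carrier G"
    and M: "(M, \<mu>) \<in> Obj (CE H)" and N: "(N, \<nu>) \<in> Obj (CE H)" and L: "(L, \<kappa>) \<in> Obj (CE H)"
    and f: "f \<in> Mor (CE H) (M, \<mu>) (N, \<nu>)" and g: "g \<in> Mor (CE H) (N, \<nu>) (L, \<kappa>)"
  shows "g \<bullet> f \<in> Mor (CE H) (M, \<mu>) (L, \<kappa>)"
proof -
  note f' = f[unfolded equi_mor_iff[OF M N]] and g' = g[unfolded equi_mor_iff[OF N L]]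
  have "\<kappa> h \<bullet> TM h (g \<bullet> f) = g \<bullet> f \<bullet> \<mu> h" if h: "h \<in> H" for h
  proof -
    have hG: "h \<in> carrier G" using H h by blast
    note a = conjunct1[OF f'] conjunct1[OF g'] equi_objD(2)[OF M H h] equi_objD(2)[OF N H h]
      equi_objD(2)[OF L H h] T_arr[OF hG conjunct1[OF f']] T_arr[OF hG conjunct1[OF g']]
    have "\<kappa> h \<bullet> TM h (g \<bullet> f) = \<kappa> h \<bullet> TM h g \<bullet> TM h f"
      using T_cmp[OF hG a(1,2)] arr_assoc[OF a(6,7,5)] by simp
    also have "\<dots> = g \<bullet> (\<nu> h \<bullet> TM h f)"
      using g' h arr_assoc[OF a(6,4,2)] by simp
    also have "\<dots> = g \<bullet> f \<bullet> \<mu> h"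
      using f' h arr_assoc[OF a(3,1,2)] by simp
    finally show ?thesis .
  qed
  then show ?thesis
    using f' g' arr_cmp unfolding equi_mor_iff[OF M L] by blast
qed

text \<open>Equivariance at \<open>h\<close> says that two group homomorphisms on the hom group of
  \<open>M\<close> and \<open>N\<close> agree at \<open>f\<close>. The equivariant morphisms
  therefore form a subgroup.\<close>

lemma comm_group_hom_grp_equi:
  assumes H: "H \<subseteq> carrier G" and AB: "A \<in> Obj (CE H)" "B \<in> Obj (CE H)"
  shows "comm_group (hom_grp (CE H) A B)"
proof -
  obtain M \<mu> N \<nu> where A: "A = (M, \<mu>)" and B: "B = (N, \<nu>)" by (cases A; cases B) auto
  note M = AB(1)[unfolded A] and N = AB(2)[unfolded B]
  note MD = equi_objD[OF M H] and ND = equi_objD[OF N H]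
  let ?S = "{f. \<guillemotleft>f : M \<rightarrow> N\<guillemotright> \<and> (\<forall>h\<in>H. \<nu> h \<bullet> TM h f = f \<bullet> \<mu> h)}"
  interpret MN: comm_group "hom_grp C M N" by (rule hom_comm_group[OF MD(1) ND(1)])
  have gh: "group_hom (hom_grp C M N) (hom_grp C (TO h M) N) (\<lambda>f. \<nu> h \<bullet> TM h f)"
    "group_hom (hom_grp C M N) (hom_grp C (TO h M) N) (\<lambda>f. f \<bullet> \<mu> h)" if h: "h \<in> H" for h
  proof -
    have hG: "h \<in> carrier G" using H h by blast
    interpret hM: comm_group "hom_grp C (TO h M) N" 
      by (rule hom_comm_group[OF T_obj[OF hG MD(1)] ND(1)])
    have "(\<lambda>f. \<nu> h \<bullet> f) \<circ> TM h \<in> hom (hom_grp C M N) (hom_grp C (TO h M) N)"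
      using T_hom[OF hG MD(1) ND(1)] hom_postcomp[OF ND(2)[OF h] T_obj[OF hG MD(1)]]
      by (rule Group.hom_compose)
    then show "group_hom (hom_grp C M N) (hom_grp C (TO h M) N) (\<lambda>f. \<nu> h \<bullet> TM h f)"
      by unfold_locales (simp add: comp_def)
    show "group_hom (hom_grp C M N) (hom_grp C (TO h M) N) (\<lambda>f. f \<bullet> \<mu> h)"
      by unfold_locales (rule hom_precomp[OF MD(2)[OF h] ND(1)])
  qed
  have "subgroup ?S (hom_grp C M N)"
  proof (rule MN.subgroupI)
    show "?S \<subseteq> carrier (hom_grp C M N)" using carrier_hom_grp MD(1) ND(1) by blast
    have "\<one>\<^bsub>hom_grp C M N\<^esub> \<in> ?S"
      using group_hom.hom_one[OF gh(1)] group_hom.hom_one[OF gh(2)]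
        carrier_hom_grp[OF MD(1) ND(1)] MN.one_closed by auto
    then show "?S \<noteq> {}" by blast
  next
    fix f assume f: "f \<in> ?S"
    then have fc: "f \<in> carrier (hom_grp C M N)" using carrier_hom_grp MD(1) ND(1) by blast
    show "inv\<^bsub>hom_grp C M N\<^esub> f \<in> ?S"
      using f fc MN.inv_closed[OF fc] group_hom.hom_inv[OF gh(1) fc] group_hom.hom_inv[OF gh(2) fc]
        MD(1) ND(1) by (simp add: carrier_hom_grp)
  next
    fix f g assume fg: "f \<in> ?S" "g \<in> ?S"
    then have c: "f \<in> carrier (hom_grp C M N)" "g \<in> carrier (hom_grp C M N)"
      using carrier_hom_grp MD(1) ND(1) by blast+
    show "f \<otimes>\<^bsub>hom_grp C M N\<^esub> g \<in> ?S"
      using fg MN.m_closed[OF c] group_hom.hom_mult[OF gh(1) c] group_hom.hom_mult[OF gh(2) c]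
        MD(1) ND(1) by (simp add: carrier_hom_grp)
  qed
  then have "comm_group (hom_grp C M N\<lparr>carrier := ?S\<rparr>)"
    by (intro group.group_comm_groupI[OF MN.subgroup_imp_group])
      (auto intro!: MN.m_comm simp: carrier_hom_grp MD(1) ND(1))
  moreover have "hom_grp C M N\<lparr>carrier := ?S\<rparr> = hom_grp (CE H) A B"
    using equi_mor_iff[OF M N] by (auto simp: hom_grp_def A B equi_simps)
  ultimately show ?thesis by simp
qed

text \<open>Composition and addition are those of \<open>C\<close>, so their laws are inherited. The
  result makes the theory of direct sums above available in the equivariantization.\<close>

lemma preadditive_category_equivariantization:
  assumes H: "H \<subseteq> carrier G"
  shows "preadditive_category (CE H)"
proof (intro preadditive_category.intro category.intro preadditive_category_axioms.intro)
  fix A assume "A \<in> Obj (CE H)"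
  moreover obtain M \<mu> where A: "A = (M, \<mu>)" by fastforce
  ultimately have M: "(M, \<mu>) \<in> Obj (CE H)" by simp
  have "\<mu> h \<bullet> TM h (Idn C M) = Idn C M \<bullet> \<mu> h" if "h \<in> H" for h
    using equi_objD[OF M H] that H arr_idn_left arr_idn_right T_idn by (metis subsetD)
  then show "Idn (CE H) A \<in> Mor (CE H) A A"
    using M equi_objD(1)[OF M H] by (simp add: A equi_simps equi_mor_iff arr_idn)
next
  fix A B E f g
  assume "A \<in> Obj (CE H)" "B \<in> Obj (CE H)" "E \<in> Obj (CE H)"
    "f \<in> Mor (CE H) A B" "g \<in> Mor (CE H) B E"
  then show "g \<cdot>\<^bsub>CE H\<^esub> f \<in> Mor (CE H) A E"
    by (cases A; cases B; cases E) (auto simp: equi_simps intro: equi_mor_cmp[OF H])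
next
  fix A B E F f g h
  assume "A \<in> Obj (CE H)" "B \<in> Obj (CE H)" "E \<in> Obj (CE H)" "F \<in> Obj (CE H)"
    "f \<in> Mor (CE H) A B" "g \<in> Mor (CE H) B E" "h \<in> Mor (CE H) E F"
  then show "h \<cdot>\<^bsub>CE H\<^esub> g \<cdot>\<^bsub>CE H\<^esub> f = h \<cdot>\<^bsub>CE H\<^esub> (g \<cdot>\<^bsub>CE H\<^esub> f)"
    by (cases A; cases B; cases E; cases F) (auto simp: equi_simps equi_mor_iff intro: arr_assoc)
next
  fix A B f
  assume "A \<in> Obj (CE H)" "B \<in> Obj (CE H)" "f \<in> Mor (CE H) A B"
  then show "Idn (CE H) B \<cdot>\<^bsub>CE H\<^esub> f = f" and "f \<cdot>\<^bsub>CE H\<^esub> Idn (CE H) A = f"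
    by (cases A; cases B; auto simp: equi_simps equi_mor_iff intro: arr_idn_left arr_idn_right)+
next
  fix A B assume "A \<in> Obj (CE H)" "B \<in> Obj (CE H)"
  then show "comm_group (hom_grp (CE H) A B)" by (rule comm_group_hom_grp_equi[OF H])
next
  fix A B E f f' g
  assume "A \<in> Obj (CE H)" "B \<in> Obj (CE H)" "E \<in> Obj (CE H)"
    "f \<in> Mor (CE H) A B" "f' \<in> Mor (CE H) A B" "g \<in> Mor (CE H) B E"
  then show "g \<cdot>\<^bsub>CE H\<^esub> Pls (CE H) f f' = Pls (CE H) (g \<cdot>\<^bsub>CE H\<^esub> f) (g \<cdot>\<^bsub>CE H\<^esub> f')"
    by (cases A; cases B; cases E) (auto simp: equi_simps equi_mor_iff arr_def intro: cmp_pls_right)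
next
  fix A B E f g g'
  assume "A \<in> Obj (CE H)" "B \<in> Obj (CE H)" "E \<in> Obj (CE H)"
    "f \<in> Mor (CE H) A B" "g \<in> Mor (CE H) B E" "g' \<in> Mor (CE H) B E"
  then show "Pls (CE H) g g' \<cdot>\<^bsub>CE H\<^esub> f = Pls (CE H) (g \<cdot>\<^bsub>CE H\<^esub> f) (g' \<cdot>\<^bsub>CE H\<^esub> f)"
    by (cases A; cases B; cases E) (auto simp: equi_simps equi_mor_iff arr_def intro: cmp_pls_left)
qed

lemma equi_Res:
  assumes M: "M \<in> Obj (CE A)" and B: "B \<subseteq> A" "subgroup B G"
  shows "Res B M \<in> Obj (CE B)"
proof -
  obtain V \<mu> where V: "M = (V, \<mu>)" by fastforce
  show ?thesis
    using M B subgroup.m_closed[OF B(2)] subgroup.one_closed[OF B(2)]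
    by (auto simp: V Res_def equivariantization_def subset_iff)
qed

text \<open>The projections of a direct sum are equivariant as soon as the injections are.\<close>

lemma equi_direct_sum:
  assumes H: "H \<subseteq> carrier G" and P: "(P, \<nu>) \<in> Obj (CE H)"
    and Q: "\<And>x. x \<in> D \<Longrightarrow> Q x \<in> Obj (CE H)"
    and j: "\<And>x. x \<in> D \<Longrightarrow> j x \<in> Mor (CE H) (Q x) (P, \<nu>)"
    and sum: "is_direct_sum C D (\<lambda>x. fst (Q x)) P j p"
  shows "is_direct_sum (CE H) D Q (P, \<nu>) j p"
proof -
  interpret E: preadditive_category "CE H" by (rule preadditive_category_equivariantization[OF H])
  note S = direct_sumD[OF sum]
  have Q': "(fst (Q x), snd (Q x)) \<in> Obj (CE H)" if "x \<in> D" for x using Q[OF that] by simp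
  note QD = equi_objD[OF Q' H] and PD = equi_objD[OF P H]
  have j': "\<nu> h \<bullet> TM h (j x) = j x \<bullet> snd (Q x) h" if "x \<in> D" "h \<in> H" for x h
    using j[OF that(1)] equi_mor_iff[OF Q'[OF that(1)] P, of "j x"] that by simp
  have p: "p x \<in> Mor (CE H) (P, \<nu>) (Q x)" if x: "x \<in> D" for x
  proof -
    have "snd (Q x) h \<bullet> TM h (p x) = p x \<bullet> \<nu> h" if h: "h \<in> H" for h
    proof -
      have hG: "h \<in> carrier G" using H h by blast
      note Th = T_direct_sum[OF hG sum]
      note px = S(4)[OF x] and qh = QD(2)[OF x h] and nh = PD(2)[OF h]
      note Tp = T_arr[OF hG px]
      \<comment> \<open>Both sides are tested on the morphisms \<open>TM h (j y)\<close>, which are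
        jointly epic since \<open>T h\<close> preserves the direct sum. Each side gives
        \<open>snd (Q x) h\<close> for \<open>y = x\<close> and zero otherwise, the right one by
        equivariance of \<open>j y\<close>.\<close>
      show ?thesis
      proof (rule direct_sum_ext[OF Th arr_cmp[OF Tp qh] arr_cmp[OF nh px]])
        fix y assume y: "y \<in> D"
        note jy = S(3)[OF y] and Tj = T_arr[OF hG S(3)[OF y]] and qy = QD(2)[OF y h]
        have "snd (Q x) h \<bullet> TM h (p x) \<bullet> TM h (j y) = snd (Q x) h \<bullet> TM h (p x \<bullet> j y)"
          using arr_assoc[OF Tj Tp qh] T_cmp[OF hG jy px] by simp
        also have "\<dots> = (if y = x then snd (Q x) h else Zro C (TO h (fst (Q y))) (fst (Q x)))"
          using S(5,6) x y hG cmp_zero_right[OF qh T_obj[OF hG S(5)[OF y]]] arr_idn_right[OF qh]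
          by (auto simp: T_idn T_zero)
        also have "\<dots> = p x \<bullet> j y \<bullet> snd (Q y) h"
          using S(5,6) x y cmp_zero_left[OF qy S(5)[OF x]] arr_idn_left[OF qy] by auto
        also have "\<dots> = p x \<bullet> (\<nu> h \<bullet> TM h (j y))"
          using arr_assoc[OF qy jy px] j'[OF y h] by simp
        also have "\<dots> = p x \<bullet> \<nu> h \<bullet> TM h (j y)"
          using arr_assoc[OF Tj nh px] by simp
        finally show "snd (Q x) h \<bullet> TM h (p x) \<bullet> TM h (j y) = p x \<bullet> \<nu> h \<bullet> TM h (j y)" .
      qed
    qed
    then show ?thesis
      using equi_mor_iff[OF P Q'[OF x], of "p x"] S(4)[OF x] by simp
  qed
  have simps: "Idn (CE H) A = Idn C (fst A)" "Zro (CE H) A B = Zro C (fst A) (fst B)" for A B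
    by (cases A; cases B; simp add: equi_simps)+
  show ?thesis
  proof (rule E.direct_sumI)
    show "finite D" by (rule S)
    show "(P, \<nu>) \<in> Obj (CE H)" by (rule P)
    show "E.arr (j x) (Q x) (P, \<nu>)" "E.arr (p x) (P, \<nu>) (Q x)" if "x \<in> D" for x
      using that j p P Q by (auto simp: E.arr_def)
    show "p y \<cdot>\<^bsub>CE H\<^esub> j x = (if x = y then Idn (CE H) (Q x) else Zro (CE H) (Q x) (Q y))"
      if "x \<in> D" "y \<in> D" for x y
      using S(6)[OF that] by (simp add: equi_simps(1) simps)
    fix f assume "E.arr f (P, \<nu>) (P, \<nu>)" and eq: "\<And>x. x \<in> D \<Longrightarrow> f \<cdot>\<^bsub>CE H\<^esub> j x = j x"
    then have "\<guillemotleft>f : P \<rightarrow> P\<guillemotright>" using equi_mor_iff[OF P P] by (simp add: E.arr_def)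
    then have "f = Idn C P"
      by (rule direct_sum_ext[OF sum _ arr_idn[OF PD(1)]])
        (use eq arr_idn_left[OF S(3)] in \<open>simp add: equi_simps\<close>)
    then show "f = Idn (CE H) (P, \<nu>)" by (simp add: equi_simps)
  qed
qed

end

section \<open>Induced objects\<close>

context abelian_action
begin

lemma left_coset_reps_iff:
  "left_coset_reps G A B R \<longleftrightarrow> R \<subseteq> A \<and> (\<forall>a\<in>A. \<exists>!r. r \<in> R \<and> (\<exists>b\<in>B. a = r \<otimes> b))"
  by (simp add: left_coset_reps_def l_coset_def)

text \<open>The morphisms \<open>\<iota> g\<close> for all \<open>g \<in> A\<close>, not only for coset representatives, extend the
  injections of the direct sum that defines the induced object.\<close>

definition is_induced ::
  "'g set \<Rightarrow> 'g set \<Rightarrow> 'o \<Rightarrow> ('g \<Rightarrow> 'm) \<Rightarrow> 'o \<Rightarrow> ('g \<Rightarrow> 'm) \<Rightarrow> ('g \<Rightarrow> 'm) \<Rightarrow> bool" where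
  "is_induced A B V \<mu> P \<nu> \<iota> \<longleftrightarrow> (P, \<nu>) \<in> Obj (CE A) \<and>
     (\<forall>g\<in>A. \<guillemotleft>\<iota> g : TO g V \<rightarrow> P\<guillemotright>) \<and>
     (\<forall>g\<in>A. \<forall>b\<in>B. \<iota> (g \<otimes> b) \<bullet> T2 g b V = \<iota> g \<bullet> TM g (\<mu> b)) \<and>
     (\<forall>g\<in>A. \<forall>t\<in>A. \<nu> g \<bullet> TM g (\<iota> t) = \<iota> (g \<otimes> t) \<bullet> T2 g t V) \<and>
     (\<exists>R \<pi>. left_coset_reps G A B R \<and> is_direct_sum C R (\<lambda>t. TO t V) P \<iota> \<pi>)"

text \<open>Passes from the construction to the properties collected in \<open>is_induced\<close>;
  everything later about induced objects rests on these alone.\<close>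

lemma induced_Ind:
  assumes A: "subgroup A G" and B: "subgroup B G" and BA: "B \<subseteq> A" and fin: "finite A"
    and V: "(V, \<mu>) \<in> Obj (CE B)" and R: "left_coset_reps G A B R"
  obtains P \<nu> \<iota> where "Ind G C T T2 A B R (V, \<mu>) = (P, \<nu>)" "is_induced A B V \<mu> P \<nu> \<iota>"
proof -
  have AG: "a \<in> carrier G" if "a \<in> A" for a using A that by (rule subgroup.mem_carrier)
  have BG: "B \<subseteq> carrier G" using B by (rule subgroup.subset)
  have RA: "R \<subseteq> A" and ex1: "\<And>a. a \<in> A \<Longrightarrow> \<exists>!r. r \<in> R \<and> (\<exists>b\<in>B. a = r \<otimes> b)"
    using R by (auto simp: left_coset_reps_iff)
  have RG: "r \<in> carrier G" if "r \<in> R" for r using RA AG that by blast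
  have BG': "b \<in> carrier G" if "b \<in> B" for b using BG that by blast
  have AB: "a \<otimes> b \<in> A" if "a \<in> A" "b \<in> B" for a b using that BA A by (auto intro: subgroup.m_closed)
  have AA: "a \<otimes> b \<in> A" if "a \<in> A" "b \<in> A" for a b using that A by (auto intro: subgroup.m_closed)
  have BB: "a \<otimes> b \<in> B" if "a \<in> B" "b \<in> B" for a b using that B by (auto intro: subgroup.m_closed)
  note VD = equi_objD[OF V BG]
  have V0: "V \<in> Obj C" by (rule VD)
  define F where "F = (\<lambda>t. TO t V)"
  define P where "P = dsum_obj C R F"
  define \<kappa> where "\<kappa> = dsum_inj C R F"
  have "\<exists>P \<iota> \<pi>. is_direct_sum C R F P \<iota> \<pi>"
    using RA fin by (intro ex_direct_sum) (auto simp: F_def intro: finite_subset T_obj[OF RG V0])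
  then obtain P' \<iota>' \<pi>' where "is_direct_sum C R F P' \<iota>' \<pi>'" by blast
  from is_direct_sum_dsum[OF this] obtain \<pi> where sum: "is_direct_sum C R F P \<kappa> \<pi>"
    unfolding P_def \<kappa>_def by blast
  note SD = direct_sumD[OF sum]
  have \<kappa>_arr: "\<guillemotleft>\<kappa> s : TO s V \<rightarrow> P\<guillemotright>" if "s \<in> R" for s using SD(3)[OF that] by (simp add: F_def)

  \<comment> \<open>With \<open>a = s \<otimes> b\<close> and \<open>s\<close> the representative of
    the coset of \<open>a\<close>, the formula for \<open>\<iota> a\<close> is forced by the
    relation \<open>\<iota>_T2\<close> below.\<close>
  define rep where "rep a = (THE r. r \<in> R \<and> (\<exists>b\<in>B. a = r \<otimes> b))" for a
  define \<iota> where "\<iota> a = (let s = rep a; b = inv s \<otimes> a in \<kappa> s \<bullet> (TM s (\<mu> b) \<bullet> T2i s b V))" for a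
  have rep_eq: "rep (s \<otimes> b) = s" if s: "s \<in> R" and b: "b \<in> B" for s b
    unfolding rep_def by (rule the1_equality[OF ex1]) (use s b RA AB in auto)
  have \<iota>_eq: "\<iota> (s \<otimes> b) = \<kappa> s \<bullet> (TM s (\<mu> b) \<bullet> T2i s b V)" if s: "s \<in> R" and b: "b \<in> B" for s b
  proof -
    have "inv s \<otimes> (s \<otimes> b) = b" using RG[OF s] BG'[OF b] by (simp add: m_assoc[symmetric])
    then show ?thesis using rep_eq[OF s b] by (simp add: \<iota>_def)
  qed
  have decomp: "\<exists>s\<in>R. \<exists>b\<in>B. a = s \<otimes> b" if "a \<in> A" for a using ex1[OF that] by blast
  have T2sb: "\<guillemotleft>T2 s b V : TO s (TO b V) \<rightarrow> TO (s \<otimes> b) V\<guillemotright>" "\<guillemotleft>T2i s b V : TO (s \<otimes> b) V \<rightarrow> TO s (TO b V)\<guillemotright>"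
    "T2i s b V \<bullet> T2 s b V = Idn C (TO s (TO b V))" "\<guillemotleft>TM s (\<mu> b) : TO s (TO b V) \<rightarrow> TO s V\<guillemotright>"
    if "s \<in> R" "b \<in> B" for s b
    using T2_iso_pair[OF RG[OF that(1)] BG'[OF that(2)] V0] T_arr[OF RG[OF that(1)] VD(2)[OF that(2)]]
    by (simp_all add: iso_pair_def)
  have \<iota>_arr: "\<guillemotleft>\<iota> a : TO a V \<rightarrow> P\<guillemotright>" if a: "a \<in> A" for a
  proof -
    obtain s b where sb: "s \<in> R" "b \<in> B" "a = s \<otimes> b" using decomp[OF a] by blast
    show ?thesis
      using arr_cmp[OF arr_cmp[OF T2sb(2,4)[OF sb(1,2)]] \<kappa>_arr[OF sb(1)]] \<iota>_eq[OF sb(1,2)] sb(3) by simp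
  qed
  have \<iota>_T2: "\<iota> (s \<otimes> b) \<bullet> T2 s b V = \<kappa> s \<bullet> TM s (\<mu> b)" if s: "s \<in> R" and b: "b \<in> B" for s b
  proof -
    note t = T2sb[OF s b] and k = \<kappa>_arr[OF s]
    have "\<iota> (s \<otimes> b) \<bullet> T2 s b V = \<kappa> s \<bullet> (TM s (\<mu> b) \<bullet> T2i s b V \<bullet> T2 s b V)"
      using \<iota>_eq[OF s b] arr_assoc[OF t(1) arr_cmp[OF t(2,4)] k] by simp
    also have "\<dots> = \<kappa> s \<bullet> TM s (\<mu> b)"
      using arr_assoc[OF t(1,2,4)] t(3) arr_idn_right[OF t(4)] by simp
    finally show ?thesis .
  qed
  have oneB: "\<one> \<in> B" using B by (rule subgroup.one_closed)
  \<comment> \<open>The case \<open>b = \<one>\<close>, where \<open>\<mu> b\<close> and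
    \<open>T2 s b V\<close> are identities by normalization.\<close>
  have \<iota>_\<kappa>: "\<iota> s = \<kappa> s" if s: "s \<in> R" for s
  proof -
    have "\<iota> s \<bullet> Idn C (TO s V) = \<kappa> s \<bullet> Idn C (TO s V)"
      using \<iota>_T2[OF s oneB] RG[OF s] V0 VD(4) T_idn[OF RG[OF s] V0]
      by (simp add: T2_one_right)
    then show ?thesis
      using arr_idn_right[OF \<kappa>_arr[OF s]] arr_idn_right[OF \<iota>_arr] RA s by auto
  qed
  have sum\<iota>: "is_direct_sum C R F P \<iota> \<pi>"
    using direct_sum_cong[OF sum] \<iota>_\<kappa> by blast

  \<comment> \<open>Extends \<open>\<iota>_T2\<close> from representatives to all
    \<open>g = s \<otimes> c\<close>. After composition with the invertible
    \<open>T2 s c (TO b V)\<close>, coherence for \<open>s\<close>, \<open>c\<close>,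
    \<open>b\<close> leads back to \<open>s\<close>, where the equivariant structure satisfies the
    coherence at \<open>c\<close> and \<open>b\<close>.\<close>
  have shift: "\<iota> (g \<otimes> b) \<bullet> T2 g b V = \<iota> g \<bullet> TM g (\<mu> b)" if g: "g \<in> A" and b: "b \<in> B" for g b
  proof -
    obtain s c where s: "s \<in> R" and c: "c \<in> B" and gsc: "g = s \<otimes> c" using decomp[OF g] by blast
    note sG = RG[OF s] and cG = BG'[OF c] and bG = BG'[OF b] and gG = AG[OF g]
    have bV: "TO b V \<in> Obj C" using T_obj[OF bG V0] .
    have iso: "iso_pair (TO s (TO c (TO b V))) (TO g (TO b V)) (T2 s c (TO b V)) (T2i s c (TO b V))"
      using T2_iso_pair[OF sG cG bV] gsc by simp
    then have t2: "\<guillemotleft>T2 s c (TO b V) : TO s (TO c (TO b V)) \<rightarrow> TO g (TO b V)\<guillemotright>" by (simp add: iso_pair_def)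
    have gb: "g \<otimes> b = s \<otimes> (c \<otimes> b)" using gsc sG cG bG by (simp add: m_assoc)
    note \<mu>b = VD(2)[OF b] and \<mu>c = VD(2)[OF c] and \<mu>cb = VD(2)[OF BB[OF c b]]
    note igb = \<iota>_arr[OF AB[OF g b]] and ig = \<iota>_arr[OF g] and ks = \<kappa>_arr[OF s]
    note T2gb = T2_arr[OF gG bG V0] and T2cb = T2_arr[OF cG bG V0]
    note T2scb = T2sb(1)[OF s BB[OF c b], folded gb] and T2sc = T2sb(1)[OF s c, folded gsc]
    note TT = T_arr[OF cG \<mu>b]
    have "\<iota> (g \<otimes> b) \<bullet> T2 g b V \<bullet> T2 s c (TO b V) = \<iota> (g \<otimes> b) \<bullet> (T2 s (c \<otimes> b) V \<bullet> TM s (T2 c b V))"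
      using arr_assoc[OF t2 T2gb igb] T2_coherence[OF V0 sG cG bG] gsc by simp
    also have "\<dots> = \<kappa> s \<bullet> TM s (\<mu> (c \<otimes> b)) \<bullet> TM s (T2 c b V)"
      using arr_assoc[OF T_arr[OF sG T2cb] T2scb igb] \<iota>_T2[OF s BB[OF c b]] gb by simp
    also have "\<dots> = \<kappa> s \<bullet> TM s (\<mu> c \<bullet> TM c (\<mu> b))"
      using arr_assoc[OF T_arr[OF sG T2cb] T_arr[OF sG \<mu>cb] ks] T_cmp[OF sG T2cb \<mu>cb] VD(3)[OF c b]
      by simp
    also have "\<dots> = \<kappa> s \<bullet> TM s (\<mu> c) \<bullet> TM s (TM c (\<mu> b))"
      using arr_assoc[OF T_arr[OF sG TT] T_arr[OF sG \<mu>c] ks] T_cmp[OF sG TT \<mu>c] by simp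
    also have "\<dots> = \<iota> g \<bullet> (T2 s c V \<bullet> TM s (TM c (\<mu> b)))"
      using arr_assoc[OF T_arr[OF sG TT] T2sc ig] \<iota>_T2[OF s c] gsc by simp
    also have "\<dots> = \<iota> g \<bullet> TM g (\<mu> b) \<bullet> T2 s c (TO b V)"
      using arr_assoc[OF t2 T_arr[OF gG \<mu>b] ig] T2_natural[OF sG cG \<mu>b] gsc by simp
    finally show ?thesis
      by (rule iso_pair_cancel_right[OF iso arr_cmp[OF T2gb igb] arr_cmp[OF T_arr[OF gG \<mu>b] ig]])
  qed

  \<comment> \<open>The morphisms \<open>TM g (\<kappa> t)\<close> are the injections of a direct
    sum, so prescribing the composites determines exactly one \<open>\<nu>\<close>; this justifies
    the \<open>THE\<close> in \<open>Ind\<close>.\<close>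
  have ex_\<nu>: "\<exists>!\<nu>. \<guillemotleft>\<nu> : TO g P \<rightarrow> P\<guillemotright> \<and> (\<forall>t\<in>R. \<nu> \<bullet> TM g (\<kappa> t) = \<iota> (g \<otimes> t) \<bullet> T2 g t V)" if g: "g \<in> A" for g
  proof -
    note TS = T_direct_sum[OF AG[OF g] sum]
    have "\<guillemotleft>\<iota> (g \<otimes> t) \<bullet> T2 g t V : TO g (F t) \<rightarrow> P\<guillemotright>" if t: "t \<in> R" for t
      unfolding F_def using RA t by (intro arr_cmp[OF T2_arr[OF AG[OF g] RG[OF t] V0] \<iota>_arr] AA g) auto
    from direct_sum_copair[OF TS SD(2) this]
    obtain u where u: "\<guillemotleft>u : TO g P \<rightarrow> P\<guillemotright>" "\<And>t. t \<in> R \<Longrightarrow> u \<bullet> TM g (\<kappa> t) = \<iota> (g \<otimes> t) \<bullet> T2 g t V"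
      by blast
    show ?thesis
    proof (rule ex1I[of _ u])
      fix v assume "\<guillemotleft>v : TO g P \<rightarrow> P\<guillemotright> \<and> (\<forall>t\<in>R. v \<bullet> TM g (\<kappa> t) = \<iota> (g \<otimes> t) \<bullet> T2 g t V)"
      then show "v = u" using u direct_sum_ext[OF TS, of v P u] by simp
    qed (use u in simp)
  qed
  define \<nu> where "\<nu> = (\<lambda>g\<in>A. THE \<nu>. \<guillemotleft>\<nu> : TO g P \<rightarrow> P\<guillemotright> \<and> (\<forall>t\<in>R. \<nu> \<bullet> TM g (\<kappa> t) = \<iota> (g \<otimes> t) \<bullet> T2 g t V))"
  have \<nu>_arr: "\<guillemotleft>\<nu> g : TO g P \<rightarrow> P\<guillemotright>" and \<nu>_\<kappa>: "t \<in> R \<Longrightarrow> \<nu> g \<bullet> TM g (\<kappa> t) = \<iota> (g \<otimes> t) \<bullet> T2 g t V"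
    if "g \<in> A" for g t
    using theI'[OF ex_\<nu>[OF that]] that by (auto simp: \<nu>_def)
  have "Ind G C T T2 A B R (V, \<mu>) = (P, \<nu>)"
  proof -
    \<comment> \<open>\<open>Ind\<close> quantifies over all factorizations of
      \<open>g \<otimes> t\<close>. One exists, and for every one of them the right-hand side equals
      \<open>\<iota> (g \<otimes> t) \<bullet> T2 g t V\<close>.\<close>
    have *: "(\<forall>s\<in>R. \<forall>b\<in>B. g \<otimes> t = s \<otimes> b \<longrightarrow> X = \<kappa> s \<bullet> (TM s (\<mu> b) \<bullet> T2i s b V \<bullet> T2 g t V)) \<longleftrightarrow>
        X = \<iota> (g \<otimes> t) \<bullet> T2 g t V" (is "?l \<longleftrightarrow> ?r") if g: "g \<in> A" and t: "t \<in> R" for g t X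
    proof -
      have gt: "g \<otimes> t \<in> A" using AA g t RA by blast
      have "\<iota> (g \<otimes> t) \<bullet> T2 g t V = \<kappa> s \<bullet> (TM s (\<mu> b) \<bullet> T2i s b V \<bullet> T2 g t V)"
        if sb: "s \<in> R" "b \<in> B" "g \<otimes> t = s \<otimes> b" for s b
        using \<iota>_eq[OF sb(1,2)] sb(3) arr_assoc[OF T2_arr[OF AG[OF g] RG[OF t] V0, unfolded sb(3)]
            arr_cmp[OF T2sb(2,4)[OF sb(1,2)]] \<kappa>_arr[OF sb(1)]] by simp
      then show ?thesis using decomp[OF gt] by metis
    qed
    have "Ind G C T T2 A B R (V, \<mu>) = (P, \<lambda>g\<in>A. THE \<nu>. \<nu> \<in> Mor C (TO g P) P \<and>
        (\<forall>t\<in>R. \<forall>s\<in>R. \<forall>b\<in>B. g \<otimes> t = s \<otimes> b \<longrightarrow>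
          \<nu> \<bullet> TM g (\<kappa> t) = \<kappa> s \<bullet> (TM s (\<mu> b) \<bullet> T2i s b V \<bullet> T2 g t V)))"
      by (simp add: Ind_def Let_def P_def \<kappa>_def F_def)
    also have "\<dots> = (P, \<nu>)"
      unfolding \<nu>_def using T_obj[OF AG SD(2)] SD(2) by (auto simp: * arr_def intro!: restrict_ext)
    finally show ?thesis .
  qed

  \<comment> \<open>Extends \<open>\<nu>_\<kappa>\<close> to all \<open>t = s \<otimes> b\<close>.
    The invertible \<open>TM g (T2 s b V)\<close> is composed on the right and cancelled at the end;
    in between, \<open>shift\<close> at \<open>g \<otimes> s\<close> and coherence for
    \<open>g\<close>, \<open>s\<close>, \<open>b\<close> are used.\<close>
  have \<nu>_\<iota>: "\<nu> g \<bullet> TM g (\<iota> t) = \<iota> (g \<otimes> t) \<bullet> T2 g t V" if g: "g \<in> A" and t: "t \<in> A" for g t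
  proof -
    obtain s b where s: "s \<in> R" and b: "b \<in> B" and t_eq: "t = s \<otimes> b" using decomp[OF t] by blast
    note sG = RG[OF s] and bG = BG'[OF b] and gG = AG[OF g] and tG = AG[OF t]
    have sA: "s \<in> A" using s RA by blast
    have gt: "g \<otimes> t = g \<otimes> s \<otimes> b" using sG bG gG t_eq by (simp add: m_assoc)
    note it = \<iota>_arr[OF t] and ks = \<kappa>_arr[OF s] and igs = \<iota>_arr[OF AA[OF g sA]]
      and igt = \<iota>_arr[OF AA[OF g t]] and ng = \<nu>_arr[OF g] and \<mu>b = VD(2)[OF b]
    note T2sb' = T2sb(1)[OF s b, folded t_eq] and T2gt = T2_arr[OF gG tG V0]
      and T2gs = T2_arr[OF gG sG V0] and T2gsb = T2_arr[OF gG sG T_obj[OF bG V0]]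
      and T2gs_b = T2_arr[OF m_closed[OF gG sG] bG V0, folded gt]
    note TT = T_arr[OF sG \<mu>b]
    have "\<nu> g \<bullet> TM g (\<iota> t) \<bullet> TM g (T2 s b V) = \<nu> g \<bullet> TM g (\<kappa> s \<bullet> TM s (\<mu> b))"
      using arr_assoc[OF T_arr[OF gG T2sb'] T_arr[OF gG it] ng] T_cmp[OF gG T2sb' it] \<iota>_T2[OF s b] t_eq
      by simp
    also have "\<dots> = \<iota> (g \<otimes> s) \<bullet> T2 g s V \<bullet> TM g (TM s (\<mu> b))"
      using T_cmp[OF gG TT ks] arr_assoc[OF T_arr[OF gG TT] T_arr[OF gG ks] ng] \<nu>_\<kappa>[OF g s] by simp
    also have "\<dots> = \<iota> (g \<otimes> s) \<bullet> (TM (g \<otimes> s) (\<mu> b) \<bullet> T2 g s (TO b V))"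
      using arr_assoc[OF T_arr[OF gG TT] T2gs igs] T2_natural[OF gG sG \<mu>b] by simp
    also have "\<dots> = \<iota> (g \<otimes> t) \<bullet> T2 (g \<otimes> s) b V \<bullet> T2 g s (TO b V)"
      using arr_assoc[OF T2gsb T_arr[OF m_closed[OF gG sG] \<mu>b] igs] shift[OF AA[OF g sA] b] gt by simp
    also have "\<dots> = \<iota> (g \<otimes> t) \<bullet> (T2 g t V \<bullet> TM g (T2 s b V))"
      using arr_assoc[OF T2gsb T2gs_b igt] T2_coherence[OF V0 gG sG bG] t_eq by simp
    also have "\<dots> = \<iota> (g \<otimes> t) \<bullet> T2 g t V \<bullet> TM g (T2 s b V)"
      using arr_assoc[OF T_arr[OF gG T2sb'] T2gt igt] by simp
    finally show ?thesis
      using T_iso_pair[OF gG T2_iso_pair[OF sG bG V0]] t_eq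
      by (intro iso_pair_cancel_right[OF _ arr_cmp[OF T_arr[OF gG it] ng] arr_cmp[OF T2gt igt]]) auto
  qed

  have "(P, \<nu>) \<in> Obj (CE A)"
  proof (rule equi_objI[OF A SD(2) _ \<nu>_arr])
    show "\<nu> \<in> extensional A" by (simp add: \<nu>_def)
  next
    fix g h assume g: "g \<in> A" and h: "h \<in> A"
    note gG = AG[OF g] and hG = AG[OF h]
    note ng = \<nu>_arr[OF g] and nh = \<nu>_arr[OF h] and ngh = \<nu>_arr[OF AA[OF g h]]
    note T2P = T2_arr[OF gG hG SD(2)]
    \<comment> \<open>Tested on the jointly epic \<open>TM g (TM h (\<iota> t))\<close>. Since
      \<open>\<nu>_\<iota>\<close> holds also at \<open>h \<otimes> t\<close>, which need not be a
      representative, both sides reduce to the coherence of \<open>T2\<close> for \<open>g\<close>,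
      \<open>h\<close>, \<open>t\<close>.\<close>
    show "\<nu> g \<bullet> TM g (\<nu> h) = \<nu> (g \<otimes> h) \<bullet> T2 g h P"
    proof (rule direct_sum_ext[OF T_direct_sum[OF gG T_direct_sum[OF hG sum\<iota>]]
          arr_cmp[OF T_arr[OF gG nh] ng] arr_cmp[OF T2P ngh]])
      fix t assume tR: "t \<in> R"
      then have t: "t \<in> A" using RA by blast
      note tG = AG[OF t] and it = \<iota>_arr[OF t] and iht = \<iota>_arr[OF AA[OF h t]]
        and ight = \<iota>_arr[OF AA[OF g AA[OF h t]]]
      have ght: "g \<otimes> h \<otimes> t = g \<otimes> (h \<otimes> t)" using gG hG tG by (rule m_assoc)
      note T2ht = T2_arr[OF hG tG V0] and Tit = T_arr[OF hG it] and T2ght = T2_arr[OF gG m_closed[OF hG tG] V0]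
        and T2gh = T2_arr[OF gG hG T_obj[OF tG V0]] and T2gh_t = T2_arr[OF m_closed[OF gG hG] tG V0]
      have "\<nu> g \<bullet> TM g (\<nu> h) \<bullet> TM g (TM h (\<iota> t)) = \<nu> g \<bullet> TM g (\<iota> (h \<otimes> t) \<bullet> T2 h t V)"
        using arr_assoc[OF T_arr[OF gG Tit] T_arr[OF gG nh] ng] T_cmp[OF gG Tit nh] \<nu>_\<iota>[OF h t] by simp
      also have "\<dots> = \<iota> (g \<otimes> (h \<otimes> t)) \<bullet> T2 g (h \<otimes> t) V \<bullet> TM g (T2 h t V)"
        using T_cmp[OF gG T2ht iht] arr_assoc[OF T_arr[OF gG T2ht] T_arr[OF gG iht] ng]
          \<nu>_\<iota>[OF g AA[OF h t]] by simp
      also have "\<dots> = \<iota> (g \<otimes> h \<otimes> t) \<bullet> (T2 (g \<otimes> h) t V \<bullet> T2 g h (TO t V))"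
        using arr_assoc[OF T_arr[OF gG T2ht] T2ght ight] T2_coherence[OF V0 gG hG tG] ght by simp
      also have "\<dots> = \<nu> (g \<otimes> h) \<bullet> TM (g \<otimes> h) (\<iota> t) \<bullet> T2 g h (TO t V)"
        using arr_assoc[OF T2gh T2gh_t ight[folded ght]] \<nu>_\<iota>[OF AA[OF g h] t] by simp
      also have "\<dots> = \<nu> (g \<otimes> h) \<bullet> (T2 g h P \<bullet> TM g (TM h (\<iota> t)))"
        using arr_assoc[OF T2gh T_arr[OF m_closed[OF gG hG] it] ngh] T2_natural[OF gG hG it] by simp
      also have "\<dots> = \<nu> (g \<otimes> h) \<bullet> T2 g h P \<bullet> TM g (TM h (\<iota> t))"
        using arr_assoc[OF T_arr[OF gG Tit] T2P ngh] by simp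
      finally show "\<nu> g \<bullet> TM g (\<nu> h) \<bullet> TM g (TM h (\<iota> t)) = \<nu> (g \<otimes> h) \<bullet> T2 g h P \<bullet> TM g (TM h (\<iota> t))" .
    qed
  next
    have oneA: "\<one> \<in> A" using oneB BA by blast
    have TP: "TO \<one> P = P" using SD(2) by (rule T_one_obj)
    show "\<nu> \<one> = Idn C P"
    proof (rule direct_sum_ext[OF sum _ arr_idn[OF SD(2)]])
      show "\<guillemotleft>\<nu> \<one> : P \<rightarrow> P\<guillemotright>" using \<nu>_arr[OF oneA] TP by simp
      fix t assume t: "t \<in> R"
      have "\<nu> \<one> \<bullet> \<kappa> t = \<iota> t \<bullet> Idn C (TO t V)"
        using \<nu>_\<kappa>[OF oneA t] T_one[OF \<kappa>_arr[OF t]] T2_one_left[OF RG[OF t] V0] RG[OF t] by simp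
      also have "\<dots> = \<kappa> t"
        using \<iota>_\<kappa>[OF t] arr_idn_right[OF \<kappa>_arr[OF t]] by simp
      finally show "\<nu> \<one> \<bullet> \<kappa> t = Idn C P \<bullet> \<kappa> t"
        using arr_idn_left[OF \<kappa>_arr[OF t]] by simp
    qed
  qed
  then have "is_induced A B V \<mu> P \<nu> \<iota>"
    unfolding is_induced_def using \<iota>_arr shift \<nu>_\<iota> R sum\<iota> by (auto simp: F_def)
  then show thesis using that \<open>Ind G C T T2 A B R (V, \<mu>) = (P, \<nu>)\<close> by blast
qed

section \<open>Change of representatives and adjunction\<close>

lemma inducedD:
  assumes "is_induced A B V \<mu> P \<nu> \<iota>"
  shows "(P, \<nu>) \<in> Obj (CE A)" "g \<in> A \<Longrightarrow> \<guillemotleft>\<iota> g : TO g V \<rightarrow> P\<guillemotright>"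
    "g \<in> A \<Longrightarrow> b \<in> B \<Longrightarrow> \<iota> (g \<otimes> b) \<bullet> T2 g b V = \<iota> g \<bullet> TM g (\<mu> b)"
    "g \<in> A \<Longrightarrow> t \<in> A \<Longrightarrow> \<nu> g \<bullet> TM g (\<iota> t) = \<iota> (g \<otimes> t) \<bullet> T2 g t V"
  using assms unfolding is_induced_def by blast+

text \<open>In the shift relation both \<open>T2 s b V\<close> and \<open>TM s (\<mu> b)\<close> are
  invertible, so within a coset of \<open>B\<close> the morphisms \<open>\<iota> g\<close> differ
  only by isomorphisms of their domains.\<close>

lemma induced_factor:
  assumes ind: "is_induced A B V \<mu> P \<nu> \<iota>" and V: "(V, \<mu>) \<in> Obj (CE B)"
    and A: "A \<subseteq> carrier G" and B: "B \<subseteq> carrier G"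
    and s: "s \<in> A" and b: "b \<in> B" and sb: "s \<otimes> b \<in> A"
  shows "\<exists>e e'. iso_pair (TO (s \<otimes> b) V) (TO s V) e e' \<and> \<iota> (s \<otimes> b) = \<iota> s \<bullet> e"
proof -
  have sG: "s \<in> carrier G" and bG: "b \<in> carrier G" using assms by blast+
  note VD = equi_objD[OF V B] and I = inducedD[OF ind]
  have V0: "V \<in> Obj C" by (rule VD)
  note iso = T2_iso_pair[OF sG bG V0]
  have i: "\<guillemotleft>T2 s b V : TO s (TO b V) \<rightarrow> TO (s \<otimes> b) V\<guillemotright>" "\<guillemotleft>T2i s b V : TO (s \<otimes> b) V \<rightarrow> TO s (TO b V)\<guillemotright>"
    "T2 s b V \<bullet> T2i s b V = Idn C (TO (s \<otimes> b) V)"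
    using iso by (simp_all add: iso_pair_def)
  have "is_iso C (TO b V) V (\<mu> b)" using VD(6)[OF b] .
  then obtain m where m: "iso_pair (TO b V) V (\<mu> b) m"
    using is_iso_iff[OF T_obj[OF bG V0] V0] by blast
  note e = iso_pair_cmp[OF iso_pair_sym[OF iso] T_iso_pair[OF sG m]]
  note ist = I(2)[OF s] and isb = I(2)[OF sb] and mb = T_arr[OF sG VD(2)[OF b]]
  have "\<iota> (s \<otimes> b) = \<iota> (s \<otimes> b) \<bullet> T2 s b V \<bullet> T2i s b V"
    using arr_assoc[OF i(2,1) isb] i(3) arr_idn_right[OF isb] by simp
  also have "\<dots> = \<iota> s \<bullet> (TM s (\<mu> b) \<bullet> T2i s b V)"
    using I(3)[OF s b] arr_assoc[OF i(2) mb ist] by simp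
  finally show ?thesis using e by blast
qed

text \<open>Matching each \<open>\<sigma> j\<close> with the representative of its coset in
  \<open>R\<close> is a bijection, and \<open>induced_factor\<close> compares the summands.
  Representatives are given as a family, so that they can later be products indexed by
  pairs.\<close>

lemma induced_transversal:
  assumes ind: "is_induced A B V \<mu> P \<nu> \<iota>" and V: "(V, \<mu>) \<in> Obj (CE B)"
    and A: "A \<subseteq> carrier G" and B: "subgroup B G"
    and \<sigma>: "\<And>j. j \<in> J \<Longrightarrow> \<sigma> j \<in> A"
    and ex1: "\<And>a. a \<in> A \<Longrightarrow> \<exists>!j. j \<in> J \<and> (\<exists>b\<in>B. a = \<sigma> j \<otimes> b)"
  obtains \<pi> where "is_direct_sum C J (\<lambda>j. TO (\<sigma> j) V) P (\<lambda>j. \<iota> (\<sigma> j)) \<pi>"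
proof -
  have BG: "B \<subseteq> carrier G" using B by (rule subgroup.subset)
  obtain R \<pi> where R: "left_coset_reps G A B R" and sum: "is_direct_sum C R (\<lambda>t. TO t V) P \<iota> \<pi>"
    using ind unfolding is_induced_def by blast
  have RA: "R \<subseteq> A" and Rex1: "\<And>a. a \<in> A \<Longrightarrow> \<exists>!r. r \<in> R \<and> (\<exists>b\<in>B. a = r \<otimes> b)"
    using R by (auto simp: left_coset_reps_iff)
  have "\<exists>r. r \<in> R \<and> (\<exists>b\<in>B. \<sigma> j = r \<otimes> b)" if "j \<in> J" for j using Rex1[OF \<sigma>[OF that]] by blast
  then obtain r where r: "\<And>j. j \<in> J \<Longrightarrow> r j \<in> R" "\<And>j. j \<in> J \<Longrightarrow> \<exists>b\<in>B. \<sigma> j = r j \<otimes> b"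
    by metis
  \<comment> \<open>Lying in the same left coset is symmetric, because \<open>B\<close> contains
    inverses.\<close>
  have swap: "\<exists>b\<in>B. y = x \<otimes> b" if x: "x \<in> A" and y: "y \<in> A" and xy: "\<exists>b\<in>B. x = y \<otimes> b" for x y
  proof -
    obtain b where b: "b \<in> B" "x = y \<otimes> b" using xy by blast
    then have "y \<in> carrier G" "b \<in> carrier G" using y A BG by auto
    then have "y = x \<otimes> inv b" using b(2) by (simp add: m_assoc)
    then show ?thesis using subgroup.m_inv_closed[OF B b(1)] by blast
  qed
  have bij: "bij_betw r J R"
  proof (rule bij_betw_imageI)
    show "inj_on r J"
    proof (rule inj_onI)
      fix i j assume i: "i \<in> J" and j: "j \<in> J" and eq: "r i = r j"
      have rA: "r j \<in> A" using r(1)[OF j] RA by blast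
      have "\<exists>b\<in>B. r j = \<sigma> i \<otimes> b" "\<exists>b\<in>B. r j = \<sigma> j \<otimes> b"
        using swap[OF \<sigma>[OF i] rA] swap[OF \<sigma>[OF j] rA] r(2)[OF i] r(2)[OF j] eq by auto
      then show "i = j" using ex1[OF rA] i j by blast
    qed
    show "r ` J = R"
    proof (intro equalityI subsetI)
      fix s assume s: "s \<in> R"
      then have sA: "s \<in> A" using RA by blast
      obtain j where j: "j \<in> J" "\<exists>b\<in>B. s = \<sigma> j \<otimes> b" using ex1[OF sA] by blast
      have "\<exists>b\<in>B. \<sigma> j = s \<otimes> b" using swap[OF sA \<sigma>[OF j(1)] j(2)] .
      then have "r j = s" using Rex1[OF \<sigma>[OF j(1)]] r[OF j(1)] s by blast
      then show "s \<in> r ` J" using j(1) by blast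
    qed (use r in auto)
  qed
  have "\<exists>e e'. iso_pair (TO (\<sigma> j) V) (TO (r j) V) e e' \<and> \<iota> (\<sigma> j) = \<iota> (r j) \<bullet> e"
    if j: "j \<in> J" for j
  proof -
    obtain b where b: "b \<in> B" "\<sigma> j = r j \<otimes> b" using r(2)[OF j] by blast
    show ?thesis
      using induced_factor[OF ind V A BG _ b(1), of "r j"] r(1)[OF j] RA \<sigma>[OF j] b(2) by auto
  qed
  then obtain e e' where e: "\<And>j. j \<in> J \<Longrightarrow> iso_pair (TO (\<sigma> j) V) (TO (r j) V) (e j) (e' j)"
    "\<And>j. j \<in> J \<Longrightarrow> \<iota> (\<sigma> j) = \<iota> (r j) \<bullet> e j"
    by metis
  have "is_direct_sum C J (\<lambda>j. TO (\<sigma> j) V) P (\<lambda>j. \<iota> (\<sigma> j)) (\<lambda>j. e' j \<bullet> \<pi> (r j))"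
    using e by (intro direct_sum_cong[OF direct_sum_reindex[OF sum bij]]) auto
  then show thesis by (rule that)
qed

text \<open>Up to an isomorphism of its domain, \<open>\<iota> g\<close> is the injection at a
  representative, and that injection is split by its projection.\<close>

lemma induced_mono:
  assumes ind: "is_induced A B V \<mu> P \<nu> \<iota>" and V: "(V, \<mu>) \<in> Obj (CE B)"
    and A: "A \<subseteq> carrier G" and B: "B \<subseteq> carrier G" and g: "g \<in> A"
    and u: "\<guillemotleft>u : E \<rightarrow> TO g V\<guillemotright>" and v: "\<guillemotleft>v : E \<rightarrow> TO g V\<guillemotright>" and eq: "\<iota> g \<bullet> u = \<iota> g \<bullet> v"
  shows "u = v"
proof -
  obtain R \<pi> where R: "left_coset_reps G A B R" and sum: "is_direct_sum C R (\<lambda>t. TO t V) P \<iota> \<pi>"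
    using ind unfolding is_induced_def by blast
  obtain s b where s: "s \<in> R" "s \<in> A" and b: "b \<in> B" and gsb: "g = s \<otimes> b"
    using R g unfolding left_coset_reps_iff by blast
  note S = direct_sumD[OF sum]
  obtain e e' where e: "iso_pair (TO g V) (TO s V) e e'" "\<iota> g = \<iota> s \<bullet> e"
    using induced_factor[OF ind V A B s(2) b] g gsb by auto
  have ea: "\<guillemotleft>e : TO g V \<rightarrow> TO s V\<guillemotright>" using e(1) by (simp add: iso_pair_def)
  have "e \<bullet> w = \<pi> s \<bullet> (\<iota> g \<bullet> w)" if w: "\<guillemotleft>w : E \<rightarrow> TO g V\<guillemotright>" for w
  proof -
    note ew = arr_cmp[OF w ea] and ist = S(3)[OF s(1)] and ps = S(4)[OF s(1)]
    have "\<pi> s \<bullet> (\<iota> g \<bullet> w) = \<pi> s \<bullet> \<iota> s \<bullet> (e \<bullet> w)"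
      using e(2) arr_assoc[OF w ea ist] arr_assoc[OF ew ist ps] by simp
    then show ?thesis using S(6)[OF s(1) s(1)] arr_idn_left[OF ew] by simp
  qed
  then have "e \<bullet> u = e \<bullet> v" using u v eq by simp
  then show ?thesis by (rule iso_pair_cancel_left[OF e(1) u v])
qed

text \<open>The half of the adjunction between induction and restriction that extends a
  \<open>B\<close>-equivariant \<open>f\<close>. The morphism \<open>u\<close> is prescribed as
  \<open>\<nu>' t \<bullet> TM t f\<close> on representatives; equivariance of \<open>f\<close>
  spreads this formula over all of \<open>A\<close>, and then \<open>u\<close> is seen to be
  \<open>A\<close>-equivariant.\<close>

lemma induced_adjoint:
  assumes ind: "is_induced A B V \<mu> P \<nu> \<iota>" and V: "(V, \<mu>) \<in> Obj (CE B)"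
    and A: "subgroup A G" and B: "subgroup B G" and BA: "B \<subseteq> A"
    and N: "(N, \<nu>') \<in> Obj (CE A)" and f: "\<guillemotleft>f : V \<rightarrow> N\<guillemotright>"
    and fB: "\<And>b. b \<in> B \<Longrightarrow> \<nu>' b \<bullet> TM b f = f \<bullet> \<mu> b"
  obtains u where "u \<in> Mor (CE A) (P, \<nu>) (N, \<nu>')" "\<And>g. g \<in> A \<Longrightarrow> u \<bullet> \<iota> g = \<nu>' g \<bullet> TM g f"
proof -
  have AG: "A \<subseteq> carrier G" and BG: "B \<subseteq> carrier G" using A B by (auto dest: subgroup.subset)
  have AG': "a \<in> carrier G" if "a \<in> A" for a using that AG by blast
  have BG': "b \<in> carrier G" if "b \<in> B" for b using that BG by blast
  note VD = equi_objD[OF V BG] and ND = equi_objD[OF N AG] and I = inducedD[OF ind]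
  note PD = equi_objD[OF I(1) AG]
  have V0: "V \<in> Obj C" by (rule VD)
  obtain R \<pi> where R: "left_coset_reps G A B R" and sum: "is_direct_sum C R (\<lambda>t. TO t V) P \<iota> \<pi>"
    using ind unfolding is_induced_def by blast
  have RA: "t \<in> A" if "t \<in> R" for t using R that by (auto simp: left_coset_reps_iff)
  have Nf: "\<guillemotleft>\<nu>' g \<bullet> TM g f : TO g V \<rightarrow> N\<guillemotright>" if "g \<in> A" for g
    using arr_cmp[OF T_arr[OF AG'[OF that] f] ND(2)[OF that]] .
  obtain u where u: "\<guillemotleft>u : P \<rightarrow> N\<guillemotright>" and uR: "\<And>t. t \<in> R \<Longrightarrow> u \<bullet> \<iota> t = \<nu>' t \<bullet> TM t f"
    using direct_sum_copair[OF sum ND(1), of "\<lambda>t. \<nu>' t \<bullet> TM t f"] Nf RA by blast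
  have uA: "u \<bullet> \<iota> g = \<nu>' g \<bullet> TM g f" if g: "g \<in> A" for g
  proof -
    obtain t b where tR: "t \<in> R" and b: "b \<in> B" and gtb: "g = t \<otimes> b"
      using R g unfolding left_coset_reps_iff by blast
    have t: "t \<in> A" and bA: "b \<in> A" using RA tR b BA by auto
    note gG = AG'[OF g] and tG = AG'[OF t] and bG = BG'[OF b]
    note ig = I(2)[OF g] and it = I(2)[OF t] and ng = ND(2)[OF g] and nt = ND(2)[OF t]
      and nb = ND(2)[OF bA] and mb = VD(2)[OF b]
    note T2tb = T2_arr[OF tG bG V0, folded gtb] and T2tbN = T2_arr[OF tG bG ND(1), folded gtb]
    note Tmb = T_arr[OF tG mb] and Tf = T_arr[OF tG f] and Tbf = T_arr[OF bG f]
    have iso: "iso_pair (TO t (TO b V)) (TO g V) (T2 t b V) (T2i t b V)"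
      using T2_iso_pair[OF tG bG V0] gtb by simp
    have "u \<bullet> \<iota> g \<bullet> T2 t b V = u \<bullet> (\<iota> t \<bullet> TM t (\<mu> b))"
      using arr_assoc[OF T2tb ig u] I(3)[OF t b] gtb by simp
    also have "\<dots> = \<nu>' t \<bullet> TM t (f \<bullet> \<mu> b)"
      using arr_assoc[OF Tmb it u] uR[OF tR] arr_assoc[OF Tmb Tf nt] T_cmp[OF tG mb f] by simp
    also have "\<dots> = \<nu>' t \<bullet> TM t (\<nu>' b) \<bullet> TM t (TM b f)"
      using arr_assoc[OF T_arr[OF tG Tbf] T_arr[OF tG nb] nt] T_cmp[OF tG Tbf nb] fB[OF b] by simp
    also have "\<dots> = \<nu>' g \<bullet> (T2 t b N \<bullet> TM t (TM b f))"
      using ND(3)[OF t bA] gtb arr_assoc[OF T_arr[OF tG Tbf] T2tbN ng] by simp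
    also have "\<dots> = \<nu>' g \<bullet> TM g f \<bullet> T2 t b V"
      using T2_natural[OF tG bG f] gtb arr_assoc[OF T2tb T_arr[OF gG f] ng] by simp
    finally show ?thesis by (rule iso_pair_cancel_right[OF iso arr_cmp[OF ig u] Nf[OF g]])
  qed
  \<comment> \<open>Tested on the \<open>TM a (\<iota> t)\<close>. As \<open>a \<otimes> t\<close>
    need not be a representative, the formula \<open>uA\<close> is needed for all elements of
    \<open>A\<close>.\<close>
  have "\<nu>' a \<bullet> TM a u = u \<bullet> \<nu> a" if a: "a \<in> A" for a
  proof -
    note aG = AG'[OF a] and na = ND(2)[OF a] and pa = PD(2)[OF a]
    note Tu = T_arr[OF aG u]
    show ?thesis
    proof (rule direct_sum_ext[OF T_direct_sum[OF aG sum] arr_cmp[OF Tu na] arr_cmp[OF pa u]])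
      fix t assume "t \<in> R"
      then have t: "t \<in> A" by (rule RA)
      have at: "a \<otimes> t \<in> A" using A a t by (rule subgroup.m_closed)
      note tG = AG'[OF t] and atG = AG'[OF at] and it = I(2)[OF t] and iat = I(2)[OF at]
        and nt = ND(2)[OF t] and nat = ND(2)[OF at]
      note Tf = T_arr[OF tG f] and T2V = T2_arr[OF aG tG V0] and T2N = T2_arr[OF aG tG ND(1)]
      have "\<nu>' a \<bullet> TM a u \<bullet> TM a (\<iota> t) = \<nu>' a \<bullet> TM a (\<nu>' t \<bullet> TM t f)"
        using arr_assoc[OF T_arr[OF aG it] Tu na] T_cmp[OF aG it u] uA[OF t] by simp
      also have "\<dots> = \<nu>' a \<bullet> TM a (\<nu>' t) \<bullet> TM a (TM t f)"
        using T_cmp[OF aG Tf nt] arr_assoc[OF T_arr[OF aG Tf] T_arr[OF aG nt] na] by simp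
      also have "\<dots> = \<nu>' (a \<otimes> t) \<bullet> (T2 a t N \<bullet> TM a (TM t f))"
        using ND(3)[OF a t] arr_assoc[OF T_arr[OF aG Tf] T2N nat] by simp
      also have "\<dots> = u \<bullet> \<iota> (a \<otimes> t) \<bullet> T2 a t V"
        using T2_natural[OF aG tG f] arr_assoc[OF T2V T_arr[OF atG f] nat] uA[OF at] by simp
      also have "\<dots> = u \<bullet> (\<nu> a \<bullet> TM a (\<iota> t))"
        using arr_assoc[OF T2V iat u] I(4)[OF a t] by simp
      also have "\<dots> = u \<bullet> \<nu> a \<bullet> TM a (\<iota> t)"
        using arr_assoc[OF T_arr[OF aG it] pa u] by simp
      finally show "\<nu>' a \<bullet> TM a u \<bullet> TM a (\<iota> t) = u \<bullet> \<nu> a \<bullet> TM a (\<iota> t)" .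
    qed
  qed
  then have "u \<in> Mor (CE A) (P, \<nu>) (N, \<nu>')"
    using u by (simp add: equi_mor_iff[OF I(1) N])
  with uA show thesis using that by blast
qed

section \<open>Conjugate subgroups, conjugated objects and double cosets\<close>

lemma conj_subgroup_iff:
  assumes "x \<in> carrier G" "H \<subseteq> carrier G"
  shows "y \<in> conj_subgroup G x H \<longleftrightarrow> y \<in> carrier G \<and> inv x \<otimes> y \<otimes> x \<in> H"
proof
  assume "y \<in> conj_subgroup G x H"
  then obtain h where h: "h \<in> H" "y = x \<otimes> h \<otimes> inv x"
    by (auto simp: conj_subgroup_def l_coset_def r_coset_def)
  have "inv x \<otimes> (x \<otimes> h \<otimes> inv x) \<otimes> x = h"
    using assms(1) subsetD[OF assms(2) h(1)] by (simp add: m_assoc) (simp add: m_assoc[symmetric])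
  then show "y \<in> carrier G \<and> inv x \<otimes> y \<otimes> x \<in> H" using h assms by auto
next
  assume y: "y \<in> carrier G \<and> inv x \<otimes> y \<otimes> x \<in> H"
  have "x \<otimes> (inv x \<otimes> y \<otimes> x) \<otimes> inv x = y"
    using assms(1) y by (simp add: m_assoc) (simp add: m_assoc[symmetric])
  then show "y \<in> conj_subgroup G x H"
    using y by (auto simp: conj_subgroup_def l_coset_def r_coset_def intro!: bexI[of _ "inv x \<otimes> y \<otimes> x"])
qed

lemma subgroup_conj_subgroup:
  assumes x: "x \<in> carrier G" and H: "subgroup H G"
  shows "subgroup (conj_subgroup G x H) G"
proof -
  note iff = conj_subgroup_iff[OF x subgroup.subset[OF H]]
  show ?thesis
  proof (rule subgroupI)
    show "conj_subgroup G x H \<subseteq> carrier G" using iff by blast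
    have "\<one> \<in> conj_subgroup G x H" using x subgroup.one_closed[OF H] by (simp add: iff)
    then show "conj_subgroup G x H \<noteq> {}" by blast
  next
    fix y assume y: "y \<in> conj_subgroup G x H"
    then have "inv (inv x \<otimes> y \<otimes> x) \<in> H" using subgroup.m_inv_closed[OF H] iff by blast
    moreover have "inv (inv x \<otimes> y \<otimes> x) = inv x \<otimes> inv y \<otimes> x"
      using x y iff by (simp add: inv_mult_group m_assoc)
    ultimately show "inv y \<in> conj_subgroup G x H" using y iff by simp
  next
    fix y z assume y: "y \<in> conj_subgroup G x H" and z: "z \<in> conj_subgroup G x H"
    then have "inv x \<otimes> y \<otimes> x \<otimes> (inv x \<otimes> z \<otimes> x) \<in> H" using subgroup.m_closed[OF H] iff by blast
    moreover have "inv x \<otimes> y \<otimes> x \<otimes> (inv x \<otimes> z \<otimes> x) = inv x \<otimes> (y \<otimes> z) \<otimes> x"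
    proof -
      have "x \<otimes> (inv x \<otimes> (z \<otimes> x)) = z \<otimes> x"
        using x z iff by (simp add: m_assoc[symmetric])
      then show ?thesis using x y z iff by (simp add: m_assoc)
    qed
    ultimately show "y \<otimes> z \<in> conj_subgroup G x H" using y z iff by simp
  qed
qed

text \<open>\<open>T\<^sup>x(M)\<close> sits inside \<open>Ind\<^sub>H\<^sup>G(M)\<close> via the monomorphism \<open>\<iota> x\<close>, which intertwines the two
  structures; this yields the coherence of the conjugated structure.\<close>

lemma Conj_equi:
  assumes ind: "is_induced (carrier G) H V \<mu> P \<nu> \<iota>" and V: "(V, \<mu>) \<in> Obj (CE H)"
    and H: "subgroup H G" and x: "x \<in> carrier G"
    and Conj: "Conj G C T T2 H x (V, \<mu>) = (W, \<xi>)"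
  shows "W = TO x V" "(W, \<xi>) \<in> Obj (CE (conj_subgroup G x H))"
    "\<And>y. y \<in> conj_subgroup G x H \<Longrightarrow> \<nu> y \<bullet> TM y (\<iota> x) = \<iota> x \<bullet> \<xi> y"
proof -
  have HG: "H \<subseteq> carrier G" using H by (rule subgroup.subset)
  let ?L = "conj_subgroup G x H"
  note iff = conj_subgroup_iff[OF x HG] and L = subgroup_conj_subgroup[OF x H]
  note VD = equi_objD[OF V HG] and I = inducedD[OF ind]
  have V0: "V \<in> Obj C" by (rule VD)
  note PD = equi_objD[OF I(1) subset_refl]
  show W: "W = TO x V" using Conj by (simp add: Conj_def)
  have LG: "y \<in> carrier G" if "y \<in> ?L" for y using that iff by blast
  have \<xi>: "\<xi> = (\<lambda>y\<in>?L. let h = inv x \<otimes> y \<otimes> x in TM x (\<mu> h) \<bullet> T2i x h V \<bullet> T2 y x V)"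
    using Conj by (simp add: Conj_def)
  have W0: "W \<in> Obj C" using T_obj[OF x V0] W by simp
  note ix = I(2)[OF x, folded W]
  \<comment> \<open>With \<open>x \<otimes> h = y \<otimes> x\<close> the shift relation identifies
    \<open>\<iota> x \<bullet> TM x (\<mu> h) \<bullet> T2i x h V\<close> with
    \<open>\<iota> (y \<otimes> x)\<close>, and \<open>\<nu> y\<close> carries
    \<open>\<iota> x\<close> to \<open>\<iota> (y \<otimes> x)\<close> up to the same
    \<open>T2 y x V\<close>.\<close>
  have key: "\<guillemotleft>\<xi> y : TO y W \<rightarrow> W\<guillemotright> \<and> \<nu> y \<bullet> TM y (\<iota> x) = \<iota> x \<bullet> \<xi> y" if y: "y \<in> ?L" for y
  proof -
    define h where "h = inv x \<otimes> y \<otimes> x"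
    have h: "h \<in> H" and yG: "y \<in> carrier G" using y iff by (auto simp: h_def)
    have hG: "h \<in> carrier G" using h HG by blast
    have xh: "x \<otimes> h = y \<otimes> x"
      unfolding h_def using x yG by (simp add: m_assoc[symmetric])
    note iso = T2_iso_pair[OF x hG V0, unfolded xh]
    have i: "\<guillemotleft>T2 x h V : TO x (TO h V) \<rightarrow> TO (y \<otimes> x) V\<guillemotright>" "\<guillemotleft>T2i x h V : TO (y \<otimes> x) V \<rightarrow> TO x (TO h V)\<guillemotright>"
      "T2 x h V \<bullet> T2i x h V = Idn C (TO (y \<otimes> x) V)"
      using iso xh by (simp_all add: iso_pair_def)
    note Tm = T_arr[OF x VD(2)[OF h], folded W] and T2yx = T2_arr[OF yG x V0, folded W]
    note iyx = I(2)[OF m_closed[OF yG x]]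
    have \<xi>y: "\<xi> y = TM x (\<mu> h) \<bullet> T2i x h V \<bullet> T2 y x V"
      using y by (simp add: \<xi> h_def Let_def)
    note TT = arr_cmp[OF i(2) Tm]
    have "\<iota> x \<bullet> \<xi> y = \<iota> x \<bullet> TM x (\<mu> h) \<bullet> T2i x h V \<bullet> T2 y x V"
      using \<xi>y arr_assoc[OF T2yx TT ix] arr_assoc[OF i(2) Tm ix] by simp
    also have "\<iota> x \<bullet> TM x (\<mu> h) \<bullet> T2i x h V = \<iota> (y \<otimes> x)"
      using I(3)[OF x h] xh arr_assoc[OF i(2,1) iyx] i(3) arr_idn_right[OF iyx] by simp
    also have "\<iota> (y \<otimes> x) \<bullet> T2 y x V = \<nu> y \<bullet> TM y (\<iota> x)"
      using I(4)[OF yG x] by simp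
    finally show ?thesis using \<xi>y arr_cmp[OF T2yx TT] by simp
  qed
  then show "\<And>y. y \<in> ?L \<Longrightarrow> \<nu> y \<bullet> TM y (\<iota> x) = \<iota> x \<bullet> \<xi> y" by blast
  have \<xi>a: "\<guillemotleft>\<xi> y : TO y W \<rightarrow> W\<guillemotright>" and \<xi>e: "\<nu> y \<bullet> TM y (\<iota> x) = \<iota> x \<bullet> \<xi> y" if "y \<in> ?L" for y
    using key[OF that] by auto
  note mono = induced_mono[OF ind V subset_refl HG x, folded W]
  show "(W, \<xi>) \<in> Obj (CE ?L)"
  proof (rule equi_objI[OF L W0 _ \<xi>a])
    show "\<xi> \<in> extensional ?L" by (simp add: \<xi>)
  next
    fix y z assume y: "y \<in> ?L" and z: "z \<in> ?L"
    have yz: "y \<otimes> z \<in> ?L" using L y z by (rule subgroup.m_closed)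
    note yG = LG[OF y] and zG = LG[OF z] and yzG = LG[OF yz]
    note T2W = T2_arr[OF yG zG W0] and T2P = T2_arr[OF yG zG PD(1)]
    note ny = PD(2)[OF yG] and nz = PD(2)[OF zG] and nyz = PD(2)[OF yzG]
    note Tz = T_arr[OF zG ix] and T\<xi> = T_arr[OF yG \<xi>a[OF z]]
    show "\<xi> y \<bullet> TM y (\<xi> z) = \<xi> (y \<otimes> z) \<bullet> T2 y z W"
    proof (rule mono[OF arr_cmp[OF T\<xi> \<xi>a[OF y]] arr_cmp[OF T2W \<xi>a[OF yz]]])
      have "\<iota> x \<bullet> (\<xi> y \<bullet> TM y (\<xi> z)) = \<nu> y \<bullet> TM y (\<iota> x) \<bullet> TM y (\<xi> z)"
        using arr_assoc[OF T\<xi> \<xi>a[OF y] ix] \<xi>e[OF y] by simp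
      also have "\<dots> = \<nu> y \<bullet> TM y (\<nu> z \<bullet> TM z (\<iota> x))"
        using arr_assoc[OF T\<xi> T_arr[OF yG ix] ny] T_cmp[OF yG \<xi>a[OF z] ix] \<xi>e[OF z] by simp
      also have "\<dots> = \<nu> y \<bullet> TM y (\<nu> z) \<bullet> TM y (TM z (\<iota> x))"
        using arr_assoc[OF T_arr[OF yG Tz] T_arr[OF yG nz] ny] T_cmp[OF yG Tz nz] by simp
      also have "\<dots> = \<nu> (y \<otimes> z) \<bullet> (T2 y z P \<bullet> TM y (TM z (\<iota> x)))"
        using PD(3)[OF yG zG] arr_assoc[OF T_arr[OF yG Tz] T2P nyz] by simp
      also have "\<dots> = \<iota> x \<bullet> \<xi> (y \<otimes> z) \<bullet> T2 y z W"
        using T2_natural[OF yG zG ix] arr_assoc[OF T2W T_arr[OF yzG ix] nyz] \<xi>e[OF yz] by simp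
      also have "\<dots> = \<iota> x \<bullet> (\<xi> (y \<otimes> z) \<bullet> T2 y z W)"
        using arr_assoc[OF T2W \<xi>a[OF yz] ix] by simp
      finally show "\<iota> x \<bullet> (\<xi> y \<bullet> TM y (\<xi> z)) = \<iota> x \<bullet> (\<xi> (y \<otimes> z) \<bullet> T2 y z W)" .
    qed
  next
    have one: "\<one> \<in> ?L" using L by (rule subgroup.one_closed)
    show "\<xi> \<one> = Idn C W"
    proof (rule mono[OF _ arr_idn[OF W0]])
      show "\<guillemotleft>\<xi> \<one> : W \<rightarrow> W\<guillemotright>" using \<xi>a[OF one] T_one_obj[OF W0] by simp
      show "\<iota> x \<bullet> \<xi> \<one> = \<iota> x \<bullet> Idn C W"
        using \<xi>e[OF one] PD(4) T_one[OF ix] arr_idn_left[OF ix] arr_idn_right[OF ix] by simp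
    qed
  qed
qed

text \<open>\<open>K\<close> acts transitively on the left cosets of \<open>H\<close> inside the
  double coset of \<open>x\<close>, and the stabilizer of \<open>x <# H\<close> is
  \<open>K \<inter> conj_subgroup G x H\<close>. Hence the products \<open>t \<otimes> x\<close>
  represent these cosets once each.\<close>

lemma double_coset_transversal:
  assumes K: "subgroup K G" and H: "subgroup H G" and D: "double_coset_reps G K H D"
    and S: "\<And>x. x \<in> D \<Longrightarrow> left_coset_reps G K (K \<inter> conj_subgroup G x H) (S x)"
    and g: "g \<in> carrier G"
  shows "\<exists>!i. i \<in> Sigma D S \<and> (\<exists>h\<in>H. g = snd i \<otimes> fst i \<otimes> h)"
proof -
  have HG: "H \<subseteq> carrier G" using H by (rule subgroup.subset)
  have KG': "k \<in> carrier G" if "k \<in> K" for k using K that by (rule subgroup.mem_carrier)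
  have HG': "h \<in> carrier G" if "h \<in> H" for h using HG that by blast
  have DG: "x \<in> carrier G" if "x \<in> D" for x using D that by (auto simp: double_coset_reps_def)
  have dc: "\<exists>!x. x \<in> D \<and> (\<exists>k\<in>K. \<exists>h\<in>H. g = k \<otimes> x \<otimes> h)"
    using D g by (simp add: double_coset_reps_def r_coset_def set_mult_def)
  have SK: "t \<in> K" if "x \<in> D" "t \<in> S x" for x t
    using S[OF that(1)] that(2) by (auto simp: left_coset_reps_iff)
  have Sex1: "\<exists>!t. t \<in> S x \<and> (\<exists>b\<in>K \<inter> conj_subgroup G x H. k = t \<otimes> b)" if "x \<in> D" "k \<in> K" for x k
    using S[OF that(1)] that(2) by (simp add: left_coset_reps_iff)
  obtain x k h where x: "x \<in> D" and k: "k \<in> K" and h: "h \<in> H" and gkxh: "g = k \<otimes> x \<otimes> h"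
    using dc by blast
  obtain t b where t: "t \<in> S x" and b: "b \<in> K" "b \<in> conj_subgroup G x H" and ktb: "k = t \<otimes> b"
    using Sex1[OF x k] by blast
  note carr = DG[OF x] KG'[OF k] HG'[OF h] KG'[OF SK[OF x t]] KG'[OF b(1)]
  have c: "inv x \<otimes> b \<otimes> x \<in> H" using b(2) conj_subgroup_iff[OF DG[OF x] HG] by blast
  \<comment> \<open>The stabilizer part \<open>b\<close> of \<open>k\<close> is moved past
    \<open>x\<close> and becomes an element of \<open>H\<close>.\<close>
  have "g = t \<otimes> x \<otimes> (inv x \<otimes> b \<otimes> x \<otimes> h)"
    using carr gkxh ktb by (simp add: m_assoc) (simp add: m_assoc[symmetric])
  then have ex: "(x, t) \<in> Sigma D S \<and> (\<exists>h\<in>H. g = snd (x, t) \<otimes> fst (x, t) \<otimes> h)"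
    using x t subgroup.m_closed[OF H c h] by auto
  show ?thesis
  proof (rule ex1I[of _ "(x, t)"], rule ex)
    fix i assume i: "i \<in> Sigma D S \<and> (\<exists>h\<in>H. g = snd i \<otimes> fst i \<otimes> h)"
    then obtain x' t' h' where i': "i = (x', t')" "x' \<in> D" "t' \<in> S x'" "h' \<in> H" "g = t' \<otimes> x' \<otimes> h'"
      by auto
    \<comment> \<open>Both factorizations place \<open>g\<close> in one double coset, which has a
      single representative in \<open>D\<close>.\<close>
    have "x' = x" using dc i' SK x k h gkxh by blast
    note t' = i'(3)[unfolded this] and g' = i'(5)[unfolded this]
    note carr' = carr KG'[OF SK[OF x t']] HG'[OF i'(4)]
    obtain h0 where h0: "h0 \<in> H" "g = t \<otimes> x \<otimes> h0" using ex by auto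
    \<comment> \<open>Comparing the two factorizations of \<open>g\<close> shows that
      \<open>b'\<close> fixes the coset of \<open>x\<close>, so \<open>t\<close> and
      \<open>t'\<close> lie in the same coset of the stabilizer.\<close>
    define b' where "b' = inv t \<otimes> t'"
    have "b' \<in> K" using SK[OF x t] SK[OF x t'] K by (simp add: b'_def subgroup.m_closed subgroup.m_inv_closed)
    moreover have "inv x \<otimes> b' \<otimes> x = h0 \<otimes> inv h'"
    proof -
      have "t' \<otimes> x = t \<otimes> x \<otimes> h0 \<otimes> inv h'"
        using g' h0 carr' HG'[OF h0(1)] by (metis inv_solve_right m_closed)
      then have "inv t \<otimes> (t' \<otimes> x) = x \<otimes> (h0 \<otimes> inv h')"
        using carr' HG'[OF h0(1)] by (simp add: m_assoc) (simp add: m_assoc[symmetric])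
      then show ?thesis
        using carr' HG'[OF h0(1)] by (simp add: b'_def m_assoc) (simp add: m_assoc[symmetric])
    qed
    then have "b' \<in> conj_subgroup G x H"
      using h0(1) i'(4) H KG'[OF \<open>b' \<in> K\<close>]
      by (simp add: conj_subgroup_iff[OF DG[OF x] HG] subgroup.m_closed subgroup.m_inv_closed)
    moreover have "t' = t \<otimes> b'" using carr' by (simp add: b'_def m_assoc[symmetric])
    \<comment> \<open>\<open>t'\<close> also represents itself, with \<open>b = \<one>\<close>, so
      uniqueness of the representative of \<open>t'\<close> gives \<open>t' = t\<close>.\<close>
    moreover have "\<exists>b\<in>K \<inter> conj_subgroup G x H. t' = t' \<otimes> b"
      using carr' subgroup.one_closed[OF K] subgroup.one_closed[OF subgroup_conj_subgroup[OF DG[OF x] H]]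
      by (intro bexI[of _ \<one>]) auto
    ultimately have "t' = t"
      using Sex1[OF x SK[OF x t']] t t' by blast
    then show "i = (x, t)" using i'(1) \<open>x' = x\<close> by simp
  qed
qed

section \<open>The Mackey decomposition\<close>

theorem mackey_decomposition:
  assumes fin: "finite (carrier G)" and K: "subgroup K G" and H: "subgroup H G"
    and M: "M \<in> Obj (CE H)"
    and R: "left_coset_reps G (carrier G) H R" and D: "double_coset_reps G K H D"
    and S: "\<And>x. x \<in> D \<Longrightarrow> left_coset_reps G K (K \<inter> conj_subgroup G x H) (S x)"
  shows "isomorphic (CE K)
    (Res K (Ind G C T T2 (carrier G) H R M))
    (dsum_obj (CE K) D
      (\<lambda>x. Ind G C T T2 K (K \<inter> conj_subgroup G x H) (S x)
        (Res (conj_subgroup G x H \<inter> K) (Conj G C T T2 H x M))))"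
proof -
  obtain V \<mu> where MV: "M = (V, \<mu>)" by fastforce
  have V: "(V, \<mu>) \<in> Obj (CE H)" using M MV by simp
  have HG: "H \<subseteq> carrier G" and KG: "K \<subseteq> carrier G" using H K by (auto dest: subgroup.subset)
  have KG': "k \<in> carrier G" if "k \<in> K" for k using KG that by blast
  have finK: "finite K" using finite_subset[OF KG fin] .
  have DG: "x \<in> carrier G" if "x \<in> D" for x using D that by (auto simp: double_coset_reps_def)
  have finD: "finite D" using finite_subset[OF _ fin] DG by blast
  have V0: "V \<in> Obj C" using equi_objD(1)[OF V HG] .
  have SK: "t \<in> K" if "x \<in> D" "t \<in> S x" for x t
    using S[OF that(1)] that(2) by (auto simp: left_coset_reps_iff)
  obtain P \<nu> \<iota> where P: "Ind G C T T2 (carrier G) H R (V, \<mu>) = (P, \<nu>)"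
    and ind: "is_induced (carrier G) H V \<mu> P \<nu> \<iota>"
    by (rule induced_Ind[OF subgroup_self H HG fin V R])
  note I = inducedD[OF ind]
  have PK: "(P, restrict \<nu> K) \<in> Obj (CE K)"
    using equi_Res[OF I(1) KG K] by (simp add: Res_def)
  let ?L = "\<lambda>x. K \<inter> conj_subgroup G x H"
  define Q where "Q = (\<lambda>x. Ind G C T T2 K (?L x) (S x) (Res (conj_subgroup G x H \<inter> K) (Conj G C T T2 H x M)))"
  have L: "subgroup (?L x) G" if "x \<in> D" for x
    using subgroups_Inter_pair[OF K subgroup_conj_subgroup[OF DG[OF that] H]] .
  \<comment> \<open>For one \<open>x\<close>, the morphism \<open>\<iota> x\<close> is equivariant
    for \<open>?L x\<close> by \<open>Conj_equi\<close>; adjunction extends it to \<open>j\<close>,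
    and its value on the component of \<open>t\<close> is the injection at
    \<open>t \<otimes> x\<close> up to \<open>T2 t x V\<close>.\<close>
  have summand: "\<exists>j \<kappa> \<rho>. Q x \<in> Obj (CE K) \<and> j \<in> Mor (CE K) (Q x) (P, restrict \<nu> K) \<and>
      is_direct_sum C (S x) (\<lambda>t. TO t (TO x V)) (fst (Q x)) \<kappa> \<rho> \<and>
      (\<forall>t\<in>S x. j \<bullet> \<kappa> t = \<iota> (t \<otimes> x) \<bullet> T2 t x V)" if x: "x \<in> D" for x
  proof -
    note xG = DG[OF x]
    obtain \<xi> where \<xi>: "Conj G C T T2 H x (V, \<mu>) = (TO x V, \<xi>)" by (simp add: Conj_def)
    note CJ = Conj_equi[OF ind V H xG \<xi>]
    have "Res (?L x) (TO x V, \<xi>) \<in> Obj (CE (?L x))"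
      by (rule equi_Res[OF CJ(2) _ L[OF x]]) simp
    then have W: "(TO x V, restrict \<xi> (?L x)) \<in> Obj (CE (?L x))" by (simp add: Res_def)
    obtain Q' \<eta> \<kappa> where Q': "Ind G C T T2 K (?L x) (S x) (TO x V, restrict \<xi> (?L x)) = (Q', \<eta>)"
      and indQ: "is_induced K (?L x) (TO x V) (restrict \<xi> (?L x)) Q' \<eta> \<kappa>"
      by (rule induced_Ind[OF K L[OF x] _ finK W S[OF x]]) simp
    have Qx: "Q x = (Q', \<eta>)" using Q' by (simp add: Q_def MV \<xi> Res_def Int_commute)
    \<comment> \<open>\<open>is_induced\<close> promises a direct sum over some system of
      representatives; here the system \<open>S x\<close> itself is needed.\<close>
    obtain \<rho> where \<rho>: "is_direct_sum C (S x) (\<lambda>t. TO t (TO x V)) Q' \<kappa> \<rho>"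
      by (rule induced_transversal[OF indQ W KG L[OF x], of "S x" "\<lambda>t. t"])
        (use SK[OF x] S[OF x] in \<open>auto simp: left_coset_reps_iff\<close>)
    have "restrict \<nu> K b \<bullet> TM b (\<iota> x) = \<iota> x \<bullet> restrict \<xi> (?L x) b" if "b \<in> ?L x" for b
      using CJ(3)[of b] that by simp
    from induced_adjoint[OF indQ W K L[OF x] _ PK I(2)[OF xG] this]
    obtain j where j: "j \<in> Mor (CE K) (Q', \<eta>) (P, restrict \<nu> K)"
      and j\<kappa>: "\<And>g. g \<in> K \<Longrightarrow> j \<bullet> \<kappa> g = restrict \<nu> K g \<bullet> TM g (\<iota> x)"
      by blast
    have "j \<bullet> \<kappa> t = \<iota> (t \<otimes> x) \<bullet> T2 t x V" if "t \<in> S x" for t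
      using j\<kappa>[OF SK[OF x that]] I(4)[OF KG'[OF SK[OF x that]] xG] SK[OF x that] by simp
    then show ?thesis
      using inducedD(1)[OF indQ] j \<rho> Qx by auto
  qed
  then obtain j \<kappa> \<rho> where QK: "\<And>x. x \<in> D \<Longrightarrow> Q x \<in> Obj (CE K)"
    and j: "\<And>x. x \<in> D \<Longrightarrow> j x \<in> Mor (CE K) (Q x) (P, restrict \<nu> K)"
    and Qsum: "\<And>x. x \<in> D \<Longrightarrow> is_direct_sum C (S x) (\<lambda>t. TO t (TO x V)) (fst (Q x)) (\<kappa> x) (\<rho> x)"
    and j\<kappa>: "\<And>x t. x \<in> D \<Longrightarrow> t \<in> S x \<Longrightarrow> j x \<bullet> \<kappa> x t = \<iota> (t \<otimes> x) \<bullet> T2 t x V"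
    by metis
  have j_arr: "\<guillemotleft>j x : fst (Q x) \<rightarrow> P\<guillemotright>" if x: "x \<in> D" for x
    using j[OF x] equi_mor_iff[of "fst (Q x)" "snd (Q x)" K P "restrict \<nu> K" "j x"] QK[OF x] PK by simp
  obtain \<pi> where P1: "is_direct_sum C (Sigma D S) (\<lambda>i. TO (snd i \<otimes> fst i) V) P (\<lambda>i. \<iota> (snd i \<otimes> fst i)) \<pi>"
    by (rule induced_transversal[OF ind V subset_refl H, of "Sigma D S" "\<lambda>i. snd i \<otimes> fst i"])
      (use double_coset_transversal[OF K H D S] SK KG' DG in auto)
  have iso: "iso_pair (TO (snd i) (TO (fst i) V)) (TO (snd i \<otimes> fst i) V)
      (T2 (snd i) (fst i) V) (T2i (snd i) (fst i) V)" if "i \<in> Sigma D S" for i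
    using that SK KG' DG by (intro T2_iso_pair V0) auto
  \<comment> \<open>Composing with \<open>T2 t x V\<close> turns the injections of \<open>P\<close>
    into exactly the morphisms that \<open>j\<kappa>\<close> produces, with summands
    \<open>TO t (TO x V)\<close>, ready for regrouping by \<open>x\<close>.\<close>
  note P2 = direct_sum_reindex[OF P1 bij_betw_id, unfolded id_apply, OF iso]
  obtain p where "is_direct_sum C D (\<lambda>x. fst (Q x)) P j p"
    using direct_sum_assoc[OF P2 finD, of "\<lambda>x. fst (Q x)" \<kappa> \<rho> j] Qsum j_arr j\<kappa> by auto
  then have "is_direct_sum (CE K) D Q (P, restrict \<nu> K) j p"
    using equi_direct_sum[OF KG PK, of D Q j p] QK j by blast
  \<comment> \<open>The restricted object itself witnesses that the family \<open>Q\<close> has a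
    direct sum in \<open>CE K\<close>, so the chosen \<open>dsum_obj\<close> is a genuine
    one.\<close>
  moreover from is_direct_sum_dsum[OF this]
  obtain p' where "is_direct_sum (CE K) D Q (dsum_obj (CE K) D Q) (dsum_inj (CE K) D Q) p'" by blast
  ultimately have "isomorphic (CE K) (P, restrict \<nu> K) (dsum_obj (CE K) D Q)"
    by (rule preadditive_category.direct_sum_isomorphic[OF preadditive_category_equivariantization[OF KG]])
  then show ?thesis
    using P by (simp add: MV Res_def Q_def)
qed

end

text \<open>\<open>Ind\<close> is formed with respect to chosen coset representatives, hence the
  parameters \<open>R\<close> and \<open>S\<close>; the isomorphism is asserted for every
  choice.\<close>

theorem theorem1p3:
  fixes G :: "('g, 'a) monoid_scheme"
    and C :: "('o, 'm) cat"
    and T :: "'g \<Rightarrow> ('o, 'm) endofun"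
    and T2 :: "'g \<Rightarrow> 'g \<Rightarrow> 'o \<Rightarrow> 'm"
    and K H D R :: "'g set"
    and S :: "'g \<Rightarrow> 'g set"
    and M :: "'o \<times> ('g \<Rightarrow> 'm)"
  assumes "group G" and "finite (carrier G)"
    and "abelian_category C"
    and "categorical_action G C T T2"
    and "subgroup K G" and "subgroup H G"
    and "M \<in> Obj (equivariantization G C T T2 H)"
    and "left_coset_reps G (carrier G) H R"
    and "double_coset_reps G K H D"
    and "\<And>x. x \<in> D \<Longrightarrow> left_coset_reps G K (K \<inter> conj_subgroup G x H) (S x)"
  shows "isomorphic (equivariantization G C T T2 K)
    (Res K (Ind G C T T2 (carrier G) H R M))
    (dsum_obj (equivariantization G C T T2 K) D
      (\<lambda>x. Ind G C T T2 K (K \<inter> conj_subgroup G x H) (S x)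
        (Res (conj_subgroup G x H \<inter> K) (Conj G C T T2 H x M))))"
  using abelian_action.mackey_decomposition[OF abelian_action.intro] assms by blast

end
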